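(* Let $G$ be a simple graph on $n$ vertices with at least one edge, where $n$ is even, and let $0=\mu_1\le\mu_2\le\cdots\le\mu_n$ be the eigenvalues of its Laplacian matrix. Let $m$ be a positive integer with $m<n/2-1$. If $\frac{\mu_2}{\mu_n}>\frac{m}{m+1}$, then $G$ is $m$-extendable.
   Context: The Laplacian matrix of $G$ is $L=D-A$ ($D$ diagonal degree matrix, $A$ adjacency matrix); $\mu_i$ is its $i$-th smallest eigenvalue. A graph $G$ on $n$ vertices is $m$-extendable (for a positive integer $m<n/2-1$) if $G$ has a perfect matching and every matching of $G$ with $m$ edges is contained in some perfect matching of $G$. *)

theory Defs
  imports
    "Jordan_Normal_Form.Char_Poly"
    "HOL-Library.Disjoint_Sets"
begin

definition simple_graph :: "'a set \<Rightarrow> 'a set set \<Rightarrow> bool" where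
  "simple_graph V E \<longleftrightarrow> finite V \<and> (\<forall>e\<in>E. e \<subseteq> V \<and> card e = 2)"

definition vertex_degree :: "'a set set \<Rightarrow> 'a \<Rightarrow> nat" where
  "vertex_degree E x = card {e \<in> E. x \<in> e}"

(* The matrices below refer to an enumeration v 0, ..., v (n - 1) of the vertices;
   in the intended use v is a bijection from {..<n} to the vertex set. *)

definition adjacency_mat :: "nat \<Rightarrow> (nat \<Rightarrow> 'a) \<Rightarrow> 'a set set \<Rightarrow> real mat" where
  "adjacency_mat n v E = mat n n (\<lambda>(i, j). if {v i, v j} \<in> E then 1 else 0)"

definition degree_mat :: "nat \<Rightarrow> (nat \<Rightarrow> 'a) \<Rightarrow> 'a set set \<Rightarrow> real mat" where
  "degree_mat n v E = mat n n (\<lambda>(i, j). if i = j then real (vertex_degree E (v i)) else 0)"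

definition laplacian_mat :: "nat \<Rightarrow> (nat \<Rightarrow> 'a) \<Rightarrow> 'a set set \<Rightarrow> real mat" where
  "laplacian_mat n v E = degree_mat n v E - adjacency_mat n v E"

(* The i-th smallest real eigenvalue, counted from i = 1 and with algebraic multiplicity.
   For a symmetric real n x n matrix all n eigenvalues are real, so every i in {1..n}
   is a meaningful index. *)

definition ith_eigenvalue :: "real mat \<Rightarrow> nat \<Rightarrow> real" where
  "ith_eigenvalue A i = sorted_list_of_multiset (proots (char_poly A)) ! (i - 1)"

definition matching :: "'a set set \<Rightarrow> 'a set set \<Rightarrow> bool" where
  "matching E M \<longleftrightarrow> M \<subseteq> E \<and> disjoint M"

definition perfect_matching :: "'a set \<Rightarrow> 'a set set \<Rightarrow> 'a set set \<Rightarrow> bool" where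
  "perfect_matching V E M \<longleftrightarrow> matching E M \<and> \<Union>M = V"

definition extendable :: "nat \<Rightarrow> 'a set \<Rightarrow> 'a set set \<Rightarrow> bool" where
  "extendable m V E \<longleftrightarrow>
     (\<exists>P. perfect_matching V E P) \<and>
     (\<forall>M. matching E M \<and> card M = m \<longrightarrow> (\<exists>P. perfect_matching V E P \<and> M \<subseteq> P))"

end

theory Submission
  imports Defs "Jordan_Normal_Form.Spectral_Radius"
begin

text \<open>Suppose that a matching \<open>M\<close> with at most \<open>m\<close> edges is not contained in a perfect matching. By
  Tutte's theorem applied to \<open>V - \<Union>M\<close>, there is a set \<open>S\<close> containing \<open>\<Union>M\<close> such that, with
  \<open>k = |S| - 2|M|\<close>, the complement of \<open>S\<close> splits into at least \<open>k + 2\<close> mutually nonadjacent parts;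
  as \<open>m \<ge> 1\<close>, we have \<open>|S| \<le> 2m + k \<le> m(k + 2)\<close>.
  On the other hand, \<open>\<mu> 2 / \<mu> n > m / (m + 1)\<close> forces \<open>mc < |S|\<close> whenever \<open>V - S\<close> splits into
  \<open>c \<ge> 2\<close> such parts. If all parts are singletons, this comes from testing the Laplacian with the
  indicator of \<open>V - S\<close> and with differences of indicators of two vertices. Otherwise the parts can
  be grouped into two nonadjacent sets \<open>X\<close> and \<open>Y\<close> with \<open>4|X||Y| \<ge> c|X \<union> Y|\<close>, and \<open>|X||Y|\<close> is
  bounded from above by the spectrum.\<close>

section \<open>Tutte's theorem\<close>

text \<open>Only the ratio of \<open>\<mu> 2\<close> and \<open>\<mu> n\<close> is controlled, so
  each spectral estimate plays a lower bound for one test function against an upper bound for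
  another whose Dirichlet form is equal or comparable. For the two nonadjacent sets this yields
  4m(m+1)|X||Y| < |V||S|, the constant being (2m+1)^2 - 1. Let c be the number of parts and N = |V -
  S|. If |S| <= mc, then also |S| <= mN, hence |V||S| <= (m+1)N * mc; the contradiction thus needs
  precisely 4|X||Y| >= cN. An odd number c >= 3 of singletons just misses this, since there N = c
  and 4|X||Y| is at most c^2 - 1. This is the obstacle behind the separate treatment of singletons.
  On the matching side, Tutte's theorem alone gives only k + 1 odd parts, which is too few for the
  final count (already for k = 0); parity supplies one more.\<close>

text \<open>A perfect matching encoded by its partner map. Alternating cycles of two matchings then
  become orbits of a composition of involutions, and switching becomes a definition by
  cases.\<close>

definition pairing_on :: "'a set \<Rightarrow> 'a set set \<Rightarrow> ('a \<Rightarrow> 'a) \<Rightarrow> bool" where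
  "pairing_on V E f \<longleftrightarrow> (\<forall>x\<in>V. f x \<in> V \<and> f x \<noteq> x \<and> f (f x) = x \<and> {x, f x} \<in> E)"

lemma pairing_onD:
  assumes "pairing_on V E f" "x \<in> V"
  shows "f x \<in> V" "f x \<noteq> x" "f (f x) = x" "{x, f x} \<in> E"
  using assms by (auto simp: pairing_on_def)

lemma pairing_on_Un:
  assumes "pairing_on A E f" "pairing_on B E g" "A \<inter> B = {}"
  shows "pairing_on (A \<union> B) E (\<lambda>x. if x \<in> A then f x else g x)"
  using assms unfolding pairing_on_def by (auto split: if_splits)

lemma clique_pairing:
  assumes "finite A" "even (card A)"
    and "\<And>x y. x \<in> A \<Longrightarrow> y \<in> A \<Longrightarrow> x \<noteq> y \<Longrightarrow> {x, y} \<in> E"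
  shows "\<exists>f. pairing_on A E f"
  using assms
proof (induction "card A" arbitrary: A rule: less_induct)
  case less
  show ?case
  proof (cases "A = {}")
    case True
    then show ?thesis by (auto simp: pairing_on_def)
  next
    case False
    then obtain a where a: "a \<in> A" by blast
    have "A \<noteq> {a}" using less.prems(2) by auto
    then obtain b where b: "b \<in> A" "b \<noteq> a" using a by blast
    let ?B = "A - {a, b}"
    have "card ?B = card A - 2"
      using a b less.prems(1) by (subst card_Diff_subset) auto
    moreover have "card A > 0" using a less.prems(1) by (auto simp: card_gt_0_iff)
    ultimately have c: "card ?B < card A" "even (card ?B)" using less.prems(2) by auto
    obtain f where f: "pairing_on ?B E f"
      using less.hyps[OF c(1) _ c(2)] less.prems by auto
    have "pairing_on {a, b} E (\<lambda>x. if x = a then b else a)"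
      using a b less.prems(3)[of a b] less.prems(3)[of b a] by (auto simp: pairing_on_def)
    from pairing_on_Un[OF this f] have "\<exists>f. pairing_on ({a, b} \<union> ?B) E f" by blast
    moreover have "{a, b} \<union> ?B = A" using a b by auto
    ultimately show ?thesis by simp
  qed
qed

lemma pairing_on_Union:
  assumes "disjoint P" "\<And>A. A \<in> P \<Longrightarrow> \<exists>f. pairing_on A E f"
  shows "\<exists>f. pairing_on (\<Union>P) E f"
proof -
  obtain F where F: "\<And>A. A \<in> P \<Longrightarrow> pairing_on A E (F A)"
    using assms(2) by metis
  define cls where "cls x = (THE A. A \<in> P \<and> x \<in> A)" for x
  have cls: "cls x = A" if "A \<in> P" "x \<in> A" for x A
    unfolding cls_def using that assms(1) by (intro the_equality) (auto simp: disjoint_def)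
  have "pairing_on (\<Union>P) E (\<lambda>x. F (cls x) x)"
    unfolding pairing_on_def
  proof
    fix x assume "x \<in> \<Union>P"
    then obtain A where A: "A \<in> P" "x \<in> A" by blast
    note p = pairing_onD[OF F[OF A(1)] A(2)]
    show "F (cls x) x \<in> \<Union>P \<and> F (cls x) x \<noteq> x \<and>
        F (cls (F (cls x) x)) (F (cls x) x) = x \<and> {x, F (cls x) x} \<in> E"
      using p A cls[OF A] cls[OF A(1) p(1)] by auto
  qed
  then show ?thesis by blast
qed

section \<open>Switching along alternating cycles\<close>

text \<open>The word p(qp)^j is a palindrome of odd length in two involutions, hence conjugate to
  its middle letter, which has no fixed point. The induction strips two letters from each end: if
  \<open>x\<close> is fixed by the word for \<open>j\<close>, then \<open>q (p x)\<close> is fixed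
  by the word for \<open>j - 2\<close>.\<close>

lemma odd_alternating_word_neq:
  assumes p: "\<And>x. x \<in> V \<Longrightarrow> p x \<in> V \<and> p x \<noteq> x \<and> p (p x) = x"
    and q: "\<And>x. x \<in> V \<Longrightarrow> q x \<in> V \<and> q x \<noteq> x \<and> q (q x) = x"
    and "x \<in> V"
  shows "p (((q \<circ> p) ^^ j) x) \<noteq> x"
  using \<open>x \<in> V\<close>
proof (induction j arbitrary: x rule: less_induct)
  case (less j)
  have gV: "((q \<circ> p) ^^ i) y \<in> V" if "y \<in> V" for i y
    using that p q by (induction i) auto
  consider "j = 0" | "j = 1" | i where "j = Suc (Suc i)"
    by (metis One_nat_def not0_implies_Suc)
  then show ?case
  proof cases
    case 1
    then show ?thesis using p less.prems by simp
  next
    case 2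
    then show ?thesis using p[of x] p[of "q (p x)"] q[of "p x"] less.prems by auto
  next
    case 3
    let ?g = "q \<circ> p"
    have gx: "?g x \<in> V" using p q less.prems by auto
    show ?thesis
    proof
      let ?y = "(?g ^^ i) (?g x)"
      have yV: "?y \<in> V" using gV[OF gx] .
      assume "p ((?g ^^ j) x) = x"
      moreover have "(?g ^^ j) x = ?g ?y"
        unfolding 3 funpow.simps(2) by (metis comp_apply funpow_swap1)
      ultimately have "p (q (p ?y)) = x" by simp
      then have "q (p ?y) = p x" using p[of "q (p ?y)"] q[of "p ?y"] p[OF yV] by auto
      then have "p ?y = ?g x" using q[of "p ?y"] p[OF yV] by auto
      moreover have "i < j" using 3 by simp
      ultimately show False using less.IH[OF _ gx, of i] by blast
    qed
  qed
qed

text \<open>The union of the two pairings consists of alternating cycles. If the cycle through \<open>d\<close> and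
  \<open>b\<close> avoids \<open>a\<close> and \<open>c\<close>, switch on this cycle; otherwise cut it at its first vertex
  in \<open>{a, c}\<close> and close the piece up with an edge to \<open>b\<close>.\<close>

lemma pairing_switch:
  assumes "finite V"
    and p1: "pairing_on V (insert {a, c} F) f1" and p2: "pairing_on V (insert {b, d} F) f2"
    and V: "a \<in> V" "b \<in> V" "c \<in> V" "d \<in> V"
    and ab: "{a, b} \<in> F" and cb: "{c, b} \<in> F"
    and "{b, d} \<notin> F" and ne: "a \<noteq> b" "c \<noteq> b" "b \<noteq> d"
  shows "\<exists>f. pairing_on V F f"
proof (cases "f1 a = c \<and> f2 b = d")
  case False
  \<comment> \<open>A pairing that does not use its added edge is already a pairing in
    \<open>F\<close>.\<close>
  have "pairing_on V F f1" if "f1 a \<noteq> c"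
    unfolding pairing_on_def
  proof
    fix x assume x: "x \<in> V"
    have "{x, f1 x} \<noteq> {a, c}"
      using that pairing_onD(3)[OF p1 V(1)] pairing_onD(3)[OF p1 x] by (auto simp: doubleton_eq_iff)
    then show "f1 x \<in> V \<and> f1 x \<noteq> x \<and> f1 (f1 x) = x \<and> {x, f1 x} \<in> F"
      using pairing_onD[OF p1 x] by auto
  qed
  moreover have "pairing_on V F f2" if "f2 b \<noteq> d"
    unfolding pairing_on_def
  proof
    fix x assume x: "x \<in> V"
    have "{x, f2 x} \<noteq> {b, d}"
      using that pairing_onD(3)[OF p2 V(2)] pairing_onD(3)[OF p2 x] by (auto simp: doubleton_eq_iff)
    then show "f2 x \<in> V \<and> f2 x \<noteq> x \<and> f2 (f2 x) = x \<and> {x, f2 x} \<in> F"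
      using pairing_onD[OF p2 x] by auto
  qed
  ultimately show ?thesis using False by blast
next
  case True
  \<comment> \<open>Extension by the identity makes \<open>p\<close> and \<open>q\<close>
    involutions everywhere, so \<open>pp\<close> and \<open>qq\<close> need no membership
    conditions.\<close>
  define p where "p x = (if x \<in> V then f1 x else x)" for x
  define q where "q x = (if x \<in> V then f2 x else x)" for x
  have pV: "p x \<in> V \<and> p x \<noteq> x \<and> p (p x) = x" and pE: "{x, p x} \<in> insert {a, c} F" if "x \<in> V" for x
    using pairing_onD[OF p1 that] that by (auto simp: p_def)
  have qV: "q x \<in> V \<and> q x \<noteq> x \<and> q (q x) = x" and qE: "{x, q x} \<in> insert {b, d} F" if "x \<in> V" for x
    using pairing_onD[OF p2 that] that by (auto simp: q_def)
  have pp: "p (p x) = x" and qq: "q (q x) = x" for x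
    using pV[of x] qV[of x] by (auto simp: p_def q_def)
  have ac: "p a = c" "p c = a" and bd: "q b = d" "q d = b"
    using True pV[OF V(1)] qV[OF V(2)] V by (auto simp: p_def q_def)
  have "a \<noteq> d" "c \<noteq> d" using ab cb \<open>{b, d} \<notin> F\<close> by (auto simp: insert_commute)
  have pF: "{x, p x} \<in> F" if "x \<in> V" "x \<noteq> a" "x \<noteq> c" for x
    using pE[OF that(1)] that by (auto simp: doubleton_eq_iff)
  have qF: "{x, q x} \<in> F" if "x \<in> V" "x \<noteq> b" "x \<noteq> d" for x
    using qE[OF that(1)] that by (auto simp: doubleton_eq_iff)
  \<comment> \<open>The walk leaves \<open>d\<close> along its \<open>p\<close>-edge, away from the
    edge {b, d}. The vertices at even distance are \<open>g i\<close>, those at odd distance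
    \<open>p (g i)\<close>.\<close>
  define g where "g i = ((q \<circ> p) ^^ i) d" for i
  have g0: "g 0 = d" and gS: "g (Suc i) = q (p (g i))" for i by (auto simp: g_def)
  have gV: "g i \<in> V" for i using V pV qV by (induction i) (auto simp: g0 gS)
  have pgV: "p (g i) \<in> V" for i using gV pV by blast
  \<comment> \<open>Both maps are injective, so a common prefix can be cancelled: the first vertex
    \<open>g i\<close> to repeat is \<open>d\<close> itself.\<close>
  have ginj: "g (i + j) = g i \<Longrightarrow> g j = d" for i j
  proof (induction i)
    case (Suc i)
    have "p (g (i + j)) = p (g i)" using Suc.prems qq by (metis add_Suc gS)
    then show ?case using Suc.IH pp by metis
  qed (simp add: g0)
  show ?thesis
  proof (cases "\<exists>k. g k = a \<or> g k = c")
    case no: False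
    \<comment> \<open>The whole cycle through \<open>b\<close> and \<open>d\<close>. Using
      \<open>p\<close> on it avoids {b, d}; using \<open>q\<close> off it avoids {a, c}, an edge
      that only \<open>p\<close> uses.\<close>
    define W where "W = range g \<union> range (\<lambda>i. p (g i))"
    have "\<not> inj g" using finite_imageD[of g UNIV] gV \<open>finite V\<close>
      by (metis finite_subset image_subsetI infinite_UNIV_nat)
    then obtain i j where "g i = g j" "i < j" by (metis injI linorder_neqE_nat)
    then have "g (j - i) = d" "j - i > 0" using ginj[of i "j - i"] by auto
    then obtain k where k: "g (Suc k) = d" using gr0_implies_Suc by metis
    have "b = p (g k)" using k bd qq gS by metis
    then have bW: "b \<in> W" by (auto simp: W_def)
    have dW: "d \<in> W" unfolding W_def using g0 by (metis UnI1 rangeI)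
    have pW: "p x \<in> W" if "x \<in> W" for x using that pp by (auto simp: W_def)
    have qW: "q x \<in> W" if "x \<in> W" for x
    proof -
      from that consider i where "x = g i" | i where "x = p (g i)" by (auto simp: W_def)
      then show ?thesis
      proof cases
        case (1 i)
        then show ?thesis using bW bd g0 qq gS
          by (cases i) (auto simp: W_def)
      next
        case (2 i)
        then have "q x = g (Suc i)" by (simp add: gS)
        then show ?thesis by (auto simp: W_def)
      qed
    qed
    have acW: "a \<notin> W" "c \<notin> W" using no unfolding W_def by (auto, (metis ac pp)+)
    have "pairing_on V F (\<lambda>x. if x \<in> W then p x else q x)"
      unfolding pairing_on_def
    proof
      fix x assume x: "x \<in> V"
      show "(if x \<in> W then p x else q x) \<in> V \<and> (if x \<in> W then p x else q x) \<noteq> x \<and>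
        (if (if x \<in> W then p x else q x) \<in> W then p (if x \<in> W then p x else q x)
         else q (if x \<in> W then p x else q x)) = x \<and> {x, if x \<in> W then p x else q x} \<in> F"
      proof (cases "x \<in> W")
        case True
        then have "x \<noteq> a" "x \<noteq> c" using acW by auto
        then show ?thesis using True pW[OF True] pV[OF x] pF[OF x] by auto
      next
        case False
        then have "q x \<notin> W" using qW[of "q x"] qq by auto
        moreover have "x \<noteq> b" "x \<noteq> d" using False bW dW by auto
        ultimately show ?thesis using False qV[OF x] qF[OF x] by auto
      qed
    qed
    then show ?thesis by blast
  next
    case True
    define k where "k = (LEAST k. g k = a \<or> g k = c)"
    define a' where "a' = g k"
    have a': "a' = a \<or> a' = c" unfolding a'_def k_def by (rule LeastI_ex[OF True])
    have less: "g i \<noteq> a" "g i \<noteq> c" if "i < k" for i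
      using not_less_Least[of i] that unfolding k_def by blast+
    have k0: "k > 0" using a' \<open>a \<noteq> d\<close> \<open>c \<noteq> d\<close> g0 by (cases k) (auto simp: a'_def)
    \<comment> \<open>The walk strictly before \<open>a'\<close>, matched within itself by
      \<open>p\<close>. Adding \<open>a'\<close> and \<open>b\<close> makes the set closed under
      \<open>q\<close>, because \<open>q\<close> takes \<open>a'\<close> back to the last vertex of
      the walk and \<open>d\<close> to \<open>b\<close>. Hence \<open>p\<close> on \<open>W\<close>,
      the edge {a', b}, and \<open>q\<close> elsewhere fit together.\<close>
    define W where "W = g ` {..<k} \<union> (\<lambda>i. p (g i)) ` {..<k}"
    have dW: "d \<in> W" unfolding W_def using g0 k0 by (metis UnI1 imageI lessThan_iff)
    have pW: "p x \<in> W" if "x \<in> W" for x using that pp by (auto simp: W_def)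
    have acW: "a \<notin> W" "c \<notin> W" using less unfolding W_def by (auto, (metis ac pp)+)
    have a'W: "a' \<notin> W" using acW a' by auto
    have bW: "b \<notin> W"
    proof
      assume "b \<in> W"
      then consider i where "i < k" "b = g i" | i where "i < k" "b = p (g i)"
        by (auto simp: W_def)
      then show False
      proof cases
        \<comment> \<open>At even distance \<open>b\<close> would make \<open>d\<close> a fixed
          point of an odd alternating word.\<close>
        case (1 i)
        then obtain j where "i = Suc j" using g0 ne by (cases i) auto
        then have "p (g j) = d" using 1 bd qq gS by metis
        then show False using odd_alternating_word_neq[OF pV qV V(4), of j] by (simp add: g_def)
      next
        \<comment> \<open>At odd distance the walk would close up at \<open>d\<close> before step
          \<open>k\<close>; by periodicity \<open>a'\<close> would then occur at the earlier index
          \<open>k - Suc i\<close>.\<close>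
        case (2 i)
        then have *: "g (Suc i) = d" using bd gS by metis
        have "g (Suc i + j) = g j" for j
          by (induction j) (use * in \<open>auto simp: g0 gS\<close>)
        from this[of "k - Suc i"] have "g (k - Suc i) = a'" using 2 by (simp add: a'_def)
        moreover have "k - Suc i < k" using 2 by simp
        ultimately show False using less a' by metis
      qed
    qed
    have a'b: "a' \<noteq> b" "a' \<in> V" "{a', b} \<in> F" using a' ne V ab cb by auto
    have closed: "q x \<in> W \<union> {a', b}" if "x \<in> W \<union> {a', b}" for x
    proof -
      have suc: "q (g i) \<in> W \<union> {a', b}" if "i \<le> k" for i
      proof (cases i)
        case (Suc j)
        then have "q (g i) = p (g j)" using qq gS by simp
        then show ?thesis using that Suc by (auto simp: W_def)
      qed (use bd g0 in auto)
      from that consider "x = b" | i where "x = g i" "i \<le> k" | i where "x = p (g i)" "i < k"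
        unfolding W_def a'_def by (auto intro: less_imp_le)
      then show ?thesis
      proof cases
        case (3 i)
        then have "q x = g (Suc i)" by (simp add: gS)
        then show ?thesis using 3 by (cases "Suc i = k") (auto simp: W_def a'_def)
      qed (use suc dW bd in auto)
    qed
    define h where "h x = (if x \<in> W then p x else if x = a' then b else if x = b then a' else q x)" for x
    have "pairing_on V F h"
      unfolding pairing_on_def
    proof
      fix x assume x: "x \<in> V"
      consider "x \<in> W" | "x = a'" | "x = b" | "x \<notin> W \<union> {a', b}" by blast
      then show "h x \<in> V \<and> h x \<noteq> x \<and> h (h x) = x \<and> {x, h x} \<in> F"
      proof cases
        case 1
        then have "x \<noteq> a" "x \<noteq> c" using acW by auto
        then show ?thesis using 1 pW[OF 1] pV[OF x] pF[OF x] by (auto simp: h_def)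
      next
        case 2
        then show ?thesis using a'W bW a'b V by (auto simp: h_def)
      next
        case 3
        then show ?thesis using a'W bW a'b V by (auto simp: h_def insert_commute)
      next
        case 4
        then have "q x \<notin> W \<union> {a', b}" using closed[of "q x"] qq by auto
        moreover have "x \<noteq> b" "x \<noteq> d" using 4 dW by auto
        ultimately show ?thesis using 4 qV[OF x] qF[OF x] by (auto simp: h_def)
      qed
    qed
    then show ?thesis by blast
  qed
qed


text \<open>Lovasz's argument: enlarge the edge set to a maximal \<open>F\<close> that still has no
  pairing, and let \<open>S\<close> consist of the vertices adjacent in \<open>F\<close> to all
  others. Maximality and switching make the components outside \<open>S\<close> cliques. Were there
  at most |S| odd cliques, each could borrow its own vertex of \<open>S\<close> and a pairing would
  exist. Parts nonadjacent in \<open>F\<close> are nonadjacent in \<open>E\<close>.\<close>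

theorem tutte:
  assumes "finite V" "even (card V)" "\<nexists>f. pairing_on V E f"
  shows "\<exists>S P. S \<subseteq> V \<and> partition_on (V - S) P \<and>
    (\<forall>A\<in>P. \<forall>B\<in>P. A \<noteq> B \<longrightarrow> (\<forall>x\<in>A. \<forall>y\<in>B. {x, y} \<notin> E)) \<and>
    card S < card {A \<in> P. odd (card A)}"
proof -
  define \<F> where "\<F> = {F. E \<inter> Pow V \<subseteq> F \<and> F \<subseteq> Pow V \<and> (\<nexists>f. pairing_on V F f)}"
  have "\<F> \<subseteq> Pow (Pow V)" by (auto simp: \<F>_def)
  then have "finite \<F>" using \<open>finite V\<close> by (meson finite_Pow_iff finite_subset)
  moreover have "E \<inter> Pow V \<in> \<F>"
    using assms(3) by (auto simp: \<F>_def pairing_on_def)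
  ultimately obtain F where F: "F \<in> \<F>" and max: "\<And>F'. F' \<in> \<F> \<Longrightarrow> F \<subseteq> F' \<Longrightarrow> F = F'"
    using finite_has_maximal2[of \<F> "E \<inter> Pow V"] by auto
  have EF: "E \<inter> Pow V \<subseteq> F" and FV: "F \<subseteq> Pow V" and noF: "\<nexists>f. pairing_on V F f"
    using F by (auto simp: \<F>_def)
  have ext: "\<exists>f. pairing_on V (insert {x, y} F) f" if "x \<in> V" "y \<in> V" "{x, y} \<notin> F" for x y
  proof (rule ccontr)
    assume "\<not> ?thesis"
    then have "insert {x, y} F \<in> \<F>" using EF FV that by (auto simp: \<F>_def)
    then show False using max[of "insert {x, y} F"] that by blast
  qed
  define S where "S = {x \<in> V. \<forall>y\<in>V. y \<noteq> x \<longrightarrow> {x, y} \<in> F}"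
  define R where "R = {(x, y). x \<in> V - S \<and> y \<in> V - S \<and> (x = y \<or> {x, y} \<in> F)}"
  have SV: "S \<subseteq> V" by (auto simp: S_def)
  \<comment> \<open>If \<open>a\<close>, \<open>b\<close>, \<open>c\<close> is a path without the
    edge {a, c}, then \<open>b\<close>, not being in \<open>S\<close>, has a non-neighbour
    \<open>d\<close>. By maximality both {a, c} and {b, d} can be added to get pairings, and
    \<open>pairing_switch\<close> produces one in \<open>F\<close> itself.\<close>
  have "trans R"
  proof (rule transI)
    fix a b c assume ab: "(a, b) \<in> R" and bc: "(b, c) \<in> R"
    show "(a, c) \<in> R"
    proof (rule ccontr)
      assume "(a, c) \<notin> R"
      then have V: "a \<in> V" "b \<in> V" "c \<in> V" and "b \<notin> S" and ac: "{a, c} \<notin> F"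
        and e: "a \<noteq> b" "c \<noteq> b" "{a, b} \<in> F" "{c, b} \<in> F"
        using ab bc by (auto simp: R_def insert_commute)
      then obtain d where d: "d \<in> V" "b \<noteq> d" "{b, d} \<notin> F" by (auto simp: S_def)
      obtain f1 f2 where "pairing_on V (insert {a, c} F) f1" "pairing_on V (insert {b, d} F) f2"
        using ext V d ac by meson
      then show False
        using pairing_switch[OF \<open>finite V\<close> _ _ V d(1) e(3,4) d(3) e(1,2) d(2)] noF by blast
    qed
  qed
  then have eq: "equiv (V - S) R"
    by (auto simp: equiv_def refl_on_def sym_def R_def insert_commute)
  define P where "P = (V - S) // R"
  have part: "partition_on (V - S) P" unfolding P_def by (rule partition_on_quotient[OF eq])
  then have PU: "\<Union>P = V - S" and disj: "disjoint P" by (auto simp: partition_on_def)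
  have clique: "{x, y} \<in> F" if "A \<in> P" "x \<in> A" "y \<in> A" "x \<noteq> y" for A x y
    using quotient_eq_iff[OF eq, of A A x y] that by (auto simp: P_def R_def)
  have nonadj: "{x, y} \<notin> E" if "A \<in> P" "B \<in> P" "A \<noteq> B" "x \<in> A" "y \<in> B" for A B x y
  proof
    assume "{x, y} \<in> E"
    moreover have V: "x \<in> V - S" "y \<in> V - S" using that PU by blast+
    ultimately have "(x, y) \<in> R" using EF by (auto simp: R_def)
    then show False using quotient_eq_iff[OF eq, of A B x y] that by (auto simp: P_def)
  qed
  have finP: "finite P" using finite_elements[OF _ part] \<open>finite V\<close> by simp
  have finA: "finite A" if "A \<in> P" for A
    using that PU \<open>finite V\<close> by (metis Sup_upper finite_Diff finite_subset)
  define Od where "Od = {A \<in> P. odd (card A)}"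
  have "card S < card Od"
  proof (rule ccontr)
    assume "\<not> card S < card Od"
    moreover have "finite S" "finite Od" using SV \<open>finite V\<close> finP finite_subset by (auto simp: Od_def)
    ultimately obtain h where h: "h ` Od \<subseteq> S" "inj_on h Od"
      using card_le_inj[of Od S] by auto
    \<comment> \<open>Odd classes are completed by a vertex of \<open>S\<close> chosen injectively,
      so all sets \<open>k A\<close> are disjoint even cliques. What remains lies in
      \<open>S\<close>, is a clique, and is even because \<open>card V\<close> is.\<close>
    define k where "k A = (if odd (card A) then insert (h A) A else A)" for A
    have hS: "h A \<in> S" if "A \<in> P" "odd (card A)" for A using h that by (auto simp: Od_def)
    have univ: "{x, y} \<in> F \<and> {y, x} \<in> F" if "x \<in> S" "y \<in> V" "y \<noteq> x" for x y
      using that by (auto simp: S_def insert_commute)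
    have PV: "A \<subseteq> V - S" if "A \<in> P" for A using PU that by blast
    have kA: "finite (k A)" "even (card (k A))" "k A \<subseteq> V" if "A \<in> P" for A
    proof -
      have "h A \<notin> A" if "odd (card A)" using hS PV that \<open>A \<in> P\<close> by blast
      then show "even (card (k A))" using finA[OF that] by (auto simp: k_def)
      show "finite (k A)" using finA[OF that] by (auto simp: k_def)
      show "k A \<subseteq> V" using PV[OF that] hS[OF that] SV by (auto simp: k_def)
    qed
    have kclique: "{x, y} \<in> F" if "A \<in> P" "x \<in> k A" "y \<in> k A" "x \<noteq> y" for A x y
    proof -
      have "A \<subseteq> V" using PV that(1) by blast
      then have "x \<in> A \<and> y \<in> A \<or> x \<in> S \<and> y \<in> V \<or> y \<in> S \<and> x \<in> V"
        using that(2,3) hS[OF that(1)] SV by (auto simp: k_def split: if_splits)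
      then show ?thesis using clique[OF that(1)] univ[of x y] univ[of y x] that(4) by auto
    qed
    have kdisj: "k A \<inter> k B = {}" if "A \<in> P" "B \<in> P" "A \<noteq> B" for A B
    proof -
      have "A \<inter> B = {}" using disj that by (auto simp: disjoint_def)
      moreover have "h A \<noteq> h B" if "odd (card A)" "odd (card B)"
        using h(2) that \<open>A \<in> P\<close> \<open>B \<in> P\<close> \<open>A \<noteq> B\<close> by (auto simp: Od_def inj_on_def)
      ultimately show ?thesis
        using PV[OF that(1)] PV[OF that(2)] hS[OF that(1)] hS[OF that(2)] by (auto simp: k_def)
    qed
    then have kd: "disjoint (k ` P)" by (auto simp: disjoint_def)
    let ?U = "\<Union>(k ` P)"
    have "\<exists>f. pairing_on (k A) F f" if "A \<in> P" for A
      using clique_pairing[of "k A" F] kA[OF that] kclique[OF that] by blast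
    then obtain f1 where f1: "pairing_on ?U F f1"
      using pairing_on_Union[OF kd] by (metis imageE)
    have "card ?U = sum card (k ` P)"
      using card_Union_disjoint[of "k ` P"] kd kA(1) by (auto simp: disjoint_def pairwise_def disjnt_def)
    moreover have "even (sum card (k ` P))" using kA by (intro dvd_sum) auto
    ultimately have evU: "even (card ?U)" by simp
    have UV: "?U \<subseteq> V" using kA by blast
    then have "card (V - ?U) = card V - card ?U" "card ?U \<le> card V"
      using \<open>finite V\<close> by (auto intro: card_Diff_subset finite_subset card_mono)
    then have ev: "even (card (V - ?U))" using evU \<open>even (card V)\<close> by auto
    have "\<Union>P \<subseteq> ?U" by (rule Union_least) (auto simp: k_def)
    then have VU: "V - ?U \<subseteq> S" unfolding PU by blast
    have cl: "{x, y} \<in> F" if "x \<in> V - ?U" "y \<in> V - ?U" "x \<noteq> y" for x y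
    proof -
      have "x \<in> S" "y \<in> V" using VU that by auto
      then show ?thesis using univ that(3) by blast
    qed
    obtain f2 where f2: "pairing_on (V - ?U) F f2"
      using clique_pairing[OF _ ev cl] \<open>finite V\<close> by auto
    have "\<exists>f. pairing_on (?U \<union> (V - ?U)) F f"
      using pairing_on_Un[OF f1 f2] by blast
    then show False using noF UV by (simp add: Un_absorb1)
  qed
  then show ?thesis using SV part nonadj unfolding Od_def by blast
qed

section \<open>Diagonalization of real symmetric matrices\<close>

lemma symmetric_scalar_prod:
  fixes A :: "'a :: comm_semiring_0 mat"
  assumes "A \<in> carrier_mat n n" "transpose_mat A = A" "x \<in> carrier_vec n" "y \<in> carrier_vec n"
  shows "x \<bullet> (A *\<^sub>v y) = (A *\<^sub>v x) \<bullet> y"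
  using transpose_vec_mult_scalar[of A n n y x] assms by simp

lemma scalar_prod_self_eq_0:
  fixes x :: "real vec"
  assumes "x \<in> carrier_vec n" "x \<bullet> x = 0"
  shows "x = 0\<^sub>v n"
  using assms by (intro eq_vecI) (auto simp: scalar_prod_def sum_nonneg_eq_0_iff)

lemma scalar_prod_self_nonneg: "0 \<le> (x :: real vec) \<bullet> x"
  by (auto simp: scalar_prod_def intro: sum_nonneg)

text \<open>A complex eigenvector z = x + iy exists. Expanding
  \<open>x \<bullet> (A *\<^sub>v y) = (A *\<^sub>v x) \<bullet> y\<close> gives Im k * (x.x + y.y)
  = 0, so the eigenvalue is real, and whichever of \<open>x\<close> and \<open>y\<close> is nonzero
  is a real eigenvector.\<close>

lemma symmetric_has_eigenvector:
  fixes A :: "real mat"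
  assumes A: "A \<in> carrier_mat n n" and sym: "transpose_mat A = A" and "n > 0"
  shows "\<exists>k v. v \<in> carrier_vec n \<and> v \<noteq> 0\<^sub>v n \<and> A *\<^sub>v v = k \<cdot>\<^sub>v v"
proof -
  let ?B = "map_mat complex_of_real A"
  have B: "?B \<in> carrier_mat n n" using A by simp
  obtain k z where z: "z \<in> carrier_vec n" "z \<noteq> 0\<^sub>v n" "?B *\<^sub>v z = k \<cdot>\<^sub>v z"
    using spectrum_non_empty[OF B \<open>n > 0\<close>] B
    by (auto simp: spectrum_def eigenvalue_def eigenvector_def)
  define x where "x = map_vec Re z"
  define y where "y = map_vec Im z"
  have c: "x \<in> carrier_vec n" "y \<in> carrier_vec n" using z by (auto simp: x_def y_def)
  have row: "(\<Sum>j<n. complex_of_real (A $$ (i, j)) * z $ j) = k * z $ i" if "i < n" for i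
    using arg_cong[OF z(3), of "\<lambda>v. v $ i"] that A z(1)
    by (simp add: scalar_prod_def row_def lessThan_atLeast0)
  have Ax: "A *\<^sub>v x = Re k \<cdot>\<^sub>v x - Im k \<cdot>\<^sub>v y"
  proof (rule eq_vecI)
    fix i assume i: "i < dim_vec (Re k \<cdot>\<^sub>v x - Im k \<cdot>\<^sub>v y)"
    then have i: "i < n" using c by simp
    show "(A *\<^sub>v x) $ i = (Re k \<cdot>\<^sub>v x - Im k \<cdot>\<^sub>v y) $ i"
      using arg_cong[OF row[OF i], of Re] i A c z(1)
      by (simp add: scalar_prod_def row_def lessThan_atLeast0 x_def y_def)
  qed (use A c in auto)
  have Ay: "A *\<^sub>v y = Re k \<cdot>\<^sub>v y + Im k \<cdot>\<^sub>v x"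
  proof (rule eq_vecI)
    fix i assume i: "i < dim_vec (Re k \<cdot>\<^sub>v y + Im k \<cdot>\<^sub>v x)"
    then have i: "i < n" using c by simp
    show "(A *\<^sub>v y) $ i = (Re k \<cdot>\<^sub>v y + Im k \<cdot>\<^sub>v x) $ i"
      using arg_cong[OF row[OF i], of Im] i A c z(1)
      by (simp add: scalar_prod_def row_def lessThan_atLeast0 x_def y_def)
  qed (use A c in auto)
  have "x \<bullet> (A *\<^sub>v y) = (A *\<^sub>v x) \<bullet> y" by (rule symmetric_scalar_prod[OF A sym c])
  then have "Im k * (x \<bullet> x + y \<bullet> y) = 0"
    unfolding Ax Ay using c
    by (simp add: scalar_prod_add_distrib[of _ n] minus_scalar_prod_distrib[of _ n] algebra_simps)
  moreover have "x \<bullet> x + y \<bullet> y \<noteq> 0"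
  proof
    assume "x \<bullet> x + y \<bullet> y = 0"
    then have "x \<bullet> x = 0" "y \<bullet> y = 0"
      using scalar_prod_self_nonneg[of x] scalar_prod_self_nonneg[of y] by linarith+
    then have xy: "x = 0\<^sub>v n" "y = 0\<^sub>v n" using scalar_prod_self_eq_0 c by auto
    have "z = 0\<^sub>v n"
    proof (rule eq_vecI)
      fix i assume "i < dim_vec (0\<^sub>v n :: complex vec)"
      then show "z $ i = 0\<^sub>v n $ i"
        using arg_cong[OF xy(1), of "\<lambda>v. v $ i"] arg_cong[OF xy(2), of "\<lambda>v. v $ i"] z(1)
        by (simp add: x_def y_def complex_eq_iff)
    qed (use z in auto)
    then show False using z by simp
  qed
  ultimately have "Im k = 0" by simp
  then have "A *\<^sub>v x = Re k \<cdot>\<^sub>v x" "A *\<^sub>v y = Re k \<cdot>\<^sub>v y"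
    unfolding Ax Ay using c by auto
  moreover have "x \<noteq> 0\<^sub>v n \<or> y \<noteq> 0\<^sub>v n" using \<open>x \<bullet> x + y \<bullet> y \<noteq> 0\<close> by auto
  ultimately show ?thesis using c by blast
qed

text \<open>The Householder reflection along \<open>w\<close>, the difference of \<open>u\<close>
  and the first unit vector: it swaps these two vectors of equal length. Being symmetric and its own
  inverse, it serves as the orthogonal change of basis in the deflation step below.\<close>

lemma reflection_to_unit_vec:
  fixes u :: "real vec"
  assumes u: "u \<in> carrier_vec n" "u \<bullet> u = 1" and "n > 0"
  shows "\<exists>H. H \<in> carrier_mat n n \<and> transpose_mat H = H \<and> H * H = 1\<^sub>m n \<and> H *\<^sub>v unit_vec n 0 = u"
proof -
  define w where "w i = u $ i - (if i = 0 then 1 else 0)" for i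
  define s where "s = (\<Sum>i<n. w i * w i)"
  text \<open>If \<open>u\<close> is the unit vector, then \<open>s = 0\<close>, hence \<open>c = 0\<close> and the reflection degenerates
    to the identity.\<close>
  define c where "c = 2 / s"
  define d where "d i j = (if i = j then 1 else 0 :: real)" for i j :: nat
  define H where "H = mat n n (\<lambda>(i, j). d i j - c * w i * w j)"
  have uu: "(\<Sum>i<n. u $ i * u $ i) = 1" using u by (simp add: scalar_prod_def lessThan_atLeast0)
  \<comment> \<open>Because \<open>u\<close> has length 1, the squared length of \<open>w\<close> is
    linear in \<open>u $ 0\<close>; hence \<open>c * w 0\<close> is -1 when \<open>s\<close> is
    nonzero, just what maps the unit vector to \<open>u\<close>.\<close>
  have "s = (\<Sum>i<n. u $ i * u $ i - 2 * (if i = 0 then u $ i else 0) + (if i = 0 then 1 else 0))"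
    unfolding s_def w_def by (intro sum.cong) (auto simp: algebra_simps)
  also have "\<dots> = 2 - 2 * u $ 0"
    using \<open>n > 0\<close> by (simp add: sum.distrib sum_subtractf uu flip: sum_distrib_left)
  finally have s: "s = - 2 * w 0" by (simp add: w_def)
  have w0: "w i = 0" if "s = 0" "i < n" for i
    using that unfolding s_def by (simp add: sum_nonneg_eq_0_iff)
  have ccs: "c * c * s = 2 * c" by (simp add: c_def)
  have "H * H = 1\<^sub>m n"
  proof (rule eq_matI)
    fix i j assume "i < dim_row (1\<^sub>m n :: real mat)" "j < dim_col (1\<^sub>m n :: real mat)"
    then have ij: "i < n" "j < n" by auto
    have "(H * H) $$ (i, j) = (\<Sum>k<n. (d i k - c * w i * w k) * (d k j - c * w k * w j))"
      using ij by (simp add: H_def scalar_prod_def lessThan_atLeast0)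
    also have "\<dots> = (\<Sum>k<n. (if k = i then d i j - c * w i * w j else 0)
        - (if k = j then c * w i * w j else 0) + c * c * w i * w j * (w k * w k))"
      by (intro sum.cong) (auto simp: d_def algebra_simps)
    also have "\<dots> = d i j - 2 * (c * w i * w j) + (c * c * s) * w i * w j"
      using ij by (simp add: sum.distrib sum_subtractf s_def flip: sum_distrib_left)
    also have "\<dots> = d i j" by (simp add: ccs)
    finally show "(H * H) $$ (i, j) = 1\<^sub>m n $$ (i, j)" using ij by (simp add: d_def)
  qed (auto simp: H_def)
  moreover have "transpose_mat H = H" by (rule eq_matI) (auto simp: H_def d_def)
  moreover have "H *\<^sub>v unit_vec n 0 = u"
  proof (rule eq_vecI)
    fix i assume "i < dim_vec u"
    then have i: "i < n" using u by simp
    have "(H *\<^sub>v unit_vec n 0) $ i = d i 0 - c * w 0 * w i"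
      using i \<open>n > 0\<close> by (simp add: H_def)
    also have "c * w 0 * w i = - w i"
      using w0[OF _ i] s by (cases "s = 0") (auto simp: c_def field_simps)
    finally show "(H *\<^sub>v unit_vec n 0) $ i = u $ i" by (simp add: w_def d_def)
  qed (use u in \<open>simp add: H_def\<close>)
  ultimately show ?thesis by (intro exI[of _ H]) (simp add: H_def)
qed

text \<open>Deflation: conjugating by the reflection that moves the first unit vector to a unit
  eigenvector clears the first column off the diagonal, and by symmetry the first row. Induction
  diagonalizes the remaining block.\<close>

theorem symmetric_mat_diagonalizable:
  fixes A :: "real mat"
  assumes "A \<in> carrier_mat n n" "transpose_mat A = A"
  shows "\<exists>P f. P \<in> carrier_mat n n \<and> P * transpose_mat P = 1\<^sub>m n \<and> transpose_mat P * P = 1\<^sub>m n \<and>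
    A = P * mat_diag n f * transpose_mat P"
  using assms
proof (induction n arbitrary: A)
  case 0
  then show ?case by (intro exI[of _ "1\<^sub>m 0"]) (auto intro!: eq_matI)
next
  case (Suc m)
  let ?n = "Suc m"
  note A = Suc.prems
  obtain k v where v: "v \<in> carrier_vec ?n" "v \<noteq> 0\<^sub>v ?n" "A *\<^sub>v v = k \<cdot>\<^sub>v v"
    using symmetric_has_eigenvector[OF A] by auto
  define u where "u = (1 / sqrt (v \<bullet> v)) \<cdot>\<^sub>v v"
  have "v \<bullet> v > 0" using scalar_prod_self_eq_0[OF v(1)] v(2) scalar_prod_self_nonneg[of v] by force
  then have u: "u \<in> carrier_vec ?n" "u \<bullet> u = 1" using v(1) by (auto simp: u_def field_simps)
  have Au: "A *\<^sub>v u = k \<cdot>\<^sub>v u"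
    using v A by (simp add: u_def mult_mat_vec[of _ ?n ?n] smult_smult_assoc mult.commute)
  obtain H where H: "H \<in> carrier_mat ?n ?n" "transpose_mat H = H" "H * H = 1\<^sub>m ?n"
    "H *\<^sub>v unit_vec ?n 0 = u"
    using reflection_to_unit_vec[OF u] by auto
  define B where "B = H * A * H"
  have B: "B \<in> carrier_mat ?n ?n" using H A by (auto simp: B_def)
  have Bsym: "transpose_mat B = B"
    using H A by (simp add: B_def transpose_mult[of _ ?n ?n _ ?n] assoc_mult_mat[of _ ?n ?n _ ?n _ ?n])
  have "H *\<^sub>v u = unit_vec ?n 0"
    using H u assoc_mult_mat_vec[of H ?n ?n H ?n "unit_vec ?n 0"] by simp
  then have "B *\<^sub>v unit_vec ?n 0 = k \<cdot>\<^sub>v unit_vec ?n 0"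
    using H A u Au
    by (simp add: B_def assoc_mult_mat_vec[of _ ?n ?n _ ?n] mult_mat_vec[of _ ?n ?n])
  moreover have "(B *\<^sub>v unit_vec ?n 0) $ i = B $$ (i, 0)" if "i < ?n" for i
    using B that by simp
  ultimately have B0: "B $$ (i, 0) = (if i = 0 then k else 0)" if "i < ?n" for i
    using that by (metis (mono_tags, lifting) index_smult_vec(1) index_unit_vec(1,3) mult.right_neutral mult_zero_right zero_less_Suc)
  have Bsym': "B $$ (i, j) = B $$ (j, i)" if "i < ?n" "j < ?n" for i j
    using B that arg_cong[OF Bsym, of "\<lambda>M. M $$ (i, j)"] by simp
  define A' where "A' = mat m m (\<lambda>(i, j). B $$ (Suc i, Suc j))"
  have A': "A' \<in> carrier_mat m m" "transpose_mat A' = A'"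
    using Bsym' by (auto simp: A'_def intro!: eq_matI)
  have Bblock: "B = four_block_mat (mat_diag 1 (\<lambda>_. k)) (0\<^sub>m 1 m) (0\<^sub>m m 1) A'"
  proof (rule eq_matI, goal_cases)
    case (1 i j)
    then have ij: "i < ?n" "j < ?n" by (auto simp: A'_def mat_diag_def)
    show ?case
      using ij B0 Bsym'[of 0 j] by (cases i; cases j) (auto simp: A'_def mat_diag_def)
  qed (use B in \<open>auto simp: A'_def mat_diag_def\<close>)
  obtain P' f where P': "P' \<in> carrier_mat m m" "P' * transpose_mat P' = 1\<^sub>m m"
    "transpose_mat P' * P' = 1\<^sub>m m" "A' = P' * mat_diag m f * transpose_mat P'"
    using Suc.IH[OF A'] by blast
  define g where "g i = (case i of 0 \<Rightarrow> k | Suc i \<Rightarrow> f i)" for i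
  have D: "mat_diag ?n g = four_block_mat (mat_diag 1 (\<lambda>_. k)) (0\<^sub>m 1 m) (0\<^sub>m m 1) (mat_diag m f)"
  proof (rule eq_matI, goal_cases)
    case (1 i j)
    then have ij: "i < ?n" "j < ?n" by (auto simp: mat_diag_def)
    show ?case using ij by (cases i; cases j) (auto simp: mat_diag_def g_def)
  qed (auto simp: mat_diag_def)
  define Q where "Q = four_block_mat (1\<^sub>m 1) (0\<^sub>m 1 m) (0\<^sub>m m 1) P'"
  have Q: "Q \<in> carrier_mat ?n ?n" using P' by (auto simp: Q_def)
  have Qt: "transpose_mat Q = four_block_mat (1\<^sub>m 1) (0\<^sub>m 1 m) (0\<^sub>m m 1) (transpose_mat P')"
    unfolding Q_def using P' by (subst transpose_four_block_mat[of _ 1 1 _ m _ m]) auto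
  have one: "four_block_mat (1\<^sub>m 1) (0\<^sub>m 1 m) (0\<^sub>m m 1) (1\<^sub>m m) = (1\<^sub>m ?n :: real mat)"
    by (rule eq_matI) auto
  have QQ: "Q * transpose_mat Q = 1\<^sub>m ?n" "transpose_mat Q * Q = 1\<^sub>m ?n"
    unfolding Qt unfolding Q_def using P'
    by (simp_all add: mult_four_block_mat[of _ 1 1 _ m _ m _ _ 1 _ m] one)
  have BQ: "B = Q * mat_diag ?n g * transpose_mat Q"
  proof -
    define K where "K = mat_diag 1 (\<lambda>_. k)"
    define G where "G = mat_diag m f"
    have c: "K \<in> carrier_mat 1 1" "G \<in> carrier_mat m m" "P' * G \<in> carrier_mat m m"
      "transpose_mat P' \<in> carrier_mat m m"
      using P' by (auto simp: K_def G_def)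
    have "Q * mat_diag ?n g = four_block_mat K (0\<^sub>m 1 m) (0\<^sub>m m 1) (P' * G)"
      unfolding Q_def D K_def[symmetric] G_def[symmetric]
      by (subst mult_four_block_mat[of _ 1 1 _ m _ m _ _ 1 _ m]) (use c P' in auto)
    then show ?thesis
      unfolding Qt Bblock P'(4) K_def[symmetric] G_def[symmetric]
      by (simp, subst mult_four_block_mat[of _ 1 1 _ m _ m _ _ 1 _ m]) (use c P' in auto)
  qed
  let ?P = "H * Q"
  have Pt: "transpose_mat ?P = transpose_mat Q * H"
    using H Q by (simp add: transpose_mult[of _ ?n ?n _ ?n])
  note assoc = assoc_mult_mat[of _ ?n ?n _ ?n _ ?n]
  have Qc: "transpose_mat Q \<in> carrier_mat ?n ?n" using Q by simp
  have Dc: "mat_diag ?n g \<in> carrier_mat ?n ?n" by simp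
  have "?P * transpose_mat ?P = H * ((Q * transpose_mat Q) * H)"
    unfolding Pt using H Q Qc by (simp add: assoc)
  moreover have "transpose_mat ?P * ?P = transpose_mat Q * ((H * H) * Q)"
    unfolding Pt using H(1) Q Qc by (simp add: assoc)
  moreover have "A = H * B * H"
  proof -
    have "H * B * H = (H * H) * A * (H * H)" unfolding B_def using H(1) A(1) by (simp add: assoc)
    then show ?thesis using H A by simp
  qed
  then have "A = ?P * mat_diag ?n g * transpose_mat ?P"
    unfolding Pt BQ using H Q Qc Dc by (simp add: assoc)
  ultimately show ?case using H Q QQ by (intro exI[of _ ?P] exI[of _ g]) auto
qed

section \<open>Eigenvalues and Rayleigh quotients\<close>

lemma proots_prod_linear_factors:
  "proots (\<Prod>a\<leftarrow>as. [:- a, 1:]) = mset (as :: 'a :: idom list)"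
proof (induction as)
  case (Cons a as)
  have "(\<Prod>a\<leftarrow>as. [:- a, 1:]) \<noteq> (0 :: 'a poly)" by (auto simp: prod_list_zero_iff)
  then show ?case using Cons by (simp add: proots_mult del: mult_pCons_left)
qed simp

lemma char_poly_orthogonally_diagonalized:
  fixes A :: "real mat"
  assumes P: "P \<in> carrier_mat n n" "P * transpose_mat P = 1\<^sub>m n" "transpose_mat P * P = 1\<^sub>m n"
    and A: "A = P * mat_diag n f * transpose_mat P"
  shows "char_poly A = (\<Prod>a\<leftarrow>map f [0..<n]. [:- a, 1:])"
proof -
  have "similar_mat_wit A (mat_diag n f) P (transpose_mat P)"
    using P A by (auto simp: similar_mat_wit_def Let_def)
  then have "char_poly A = char_poly (mat_diag n f)"
    by (intro char_poly_similar) (auto simp: similar_mat_def)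
  also have "\<dots> = (\<Prod>a\<leftarrow>diag_mat (mat_diag n f). [:- a, 1:])"
    by (rule char_poly_upper_triangular[of _ n]) (auto simp: mat_diag_def)
  also have "diag_mat (mat_diag n f) = map f [0..<n]" by (auto simp: diag_mat_def mat_diag_def)
  finally show ?thesis .
qed

text \<open>For lists with fewer than two entries \<open>xs ! 1\<close> is unspecified, and the
  bound holds by length alone.\<close>

lemma length_filter_less_nth_1:
  assumes "sorted xs"
  shows "length (filter (\<lambda>x. x < xs ! 1) xs) \<le> 1"
proof (cases xs rule: remdups_adj.cases)
  case (3 x y ys)
  then have "\<forall>z\<in>set (y # ys). y \<le> z" using assms by auto
  then have "filter (\<lambda>x. x < y) (y # ys) = []" by (auto simp: filter_empty_conv not_less)
  then show ?thesis using 3 by simp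
qed simp_all

text \<open>Index 1 of the sorted list is the second smallest value, so two different indices cannot
  both lie below it. This tells, without permuting the eigenbasis, that all but one eigenvalue are
  at least \<open>\<mu> 2\<close>.\<close>

lemma sort_map_nth_1_le:
  fixes f :: "nat \<Rightarrow> 'a :: linorder"
  assumes "i < n" "j < n" "i \<noteq> j" "f i < sort (map f [0..<n]) ! 1"
  shows "sort (map f [0..<n]) ! 1 \<le> f j"
proof (rule ccontr)
  let ?xs = "sort (map f [0..<n])"
  assume "\<not> ?thesis"
  then have "{i, j} \<subseteq> {k. k < n \<and> f k < ?xs ! 1}" using assms by auto
  then have "card {i, j} \<le> card {k. k < n \<and> f k < ?xs ! 1}" by (intro card_mono) auto
  also have "\<dots> = length (filter (\<lambda>x. x < ?xs ! 1) (map f [0..<n]))"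
    by (auto simp: length_filter_conv_card intro!: arg_cong[where f = card])
  also have "\<dots> = length (filter (\<lambda>x. x < ?xs ! 1) ?xs)"
    by (metis mset_filter mset_sort size_mset)
  also have "\<dots> \<le> 1"
    using length_filter_less_nth_1[of ?xs] by simp
  finally show False using \<open>i \<noteq> j\<close> by simp
qed

lemma le_last_sort_map:
  fixes f :: "nat \<Rightarrow> 'a :: linorder"
  assumes "i < n"
  shows "f i \<le> sort (map f [0..<n]) ! (n - 1)"
proof -
  let ?xs = "sort (map f [0..<n])"
  have "f i \<in> set ?xs" using assms by simp
  then obtain k where "k < length ?xs" "f i = ?xs ! k" unfolding in_set_conv_nth by metis
  then show ?thesis using sorted_nth_mono[of ?xs k "n - 1"] by simp
qed

text \<open>Interface to the diagonalization: coordinates in the eigenbasis, in which the scalar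
  product keeps its form and the quadratic form is diagonal. The last property transfers
  nonnegativity of the quadratic form to the eigenvalues \<open>f i\<close>.\<close>

lemma symmetric_mat_eigenbasis:
  fixes A :: "real mat"
  assumes A: "A \<in> carrier_mat n n" "transpose_mat A = A"
  obtains f P where "P \<in> carrier_mat n n"
    "\<And>x. x \<in> carrier_vec n \<Longrightarrow> P *\<^sub>v (transpose_mat P *\<^sub>v x) = x"
    "\<And>x y. x \<in> carrier_vec n \<Longrightarrow> y \<in> carrier_vec n \<Longrightarrow>
       x \<bullet> y = (\<Sum>i<n. (transpose_mat P *\<^sub>v x) $ i * (transpose_mat P *\<^sub>v y) $ i)"
    "\<And>x. x \<in> carrier_vec n \<Longrightarrow> x \<bullet> (A *\<^sub>v x) = (\<Sum>i<n. f i * ((transpose_mat P *\<^sub>v x) $ i)\<^sup>2)"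
    "\<And>i. ith_eigenvalue A i = sort (map f [0..<n]) ! (i - 1)"
    "\<And>i. i < n \<Longrightarrow> \<exists>x\<in>carrier_vec n. x \<bullet> (A *\<^sub>v x) = f i"
proof -
  obtain P f where P: "P \<in> carrier_mat n n" "P * transpose_mat P = 1\<^sub>m n" "transpose_mat P * P = 1\<^sub>m n"
    and APf: "A = P * mat_diag n f * transpose_mat P"
    using symmetric_mat_diagonalizable[OF A] by blast
  have Pt: "transpose_mat P \<in> carrier_mat n n" using P by simp
  have 1: "P *\<^sub>v (transpose_mat P *\<^sub>v x) = x" if "x \<in> carrier_vec n" for x
    using that P Pt assoc_mult_mat_vec[OF P(1) Pt that] by simp
  have 2: "transpose_mat P *\<^sub>v (P *\<^sub>v x) = x" if "x \<in> carrier_vec n" for x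
    using that P Pt assoc_mult_mat_vec[OF Pt P(1) that] by simp
  have move: "x \<bullet> (P *\<^sub>v y) = (\<Sum>i<n. (transpose_mat P *\<^sub>v x) $ i * y $ i)"
    if "x \<in> carrier_vec n" "y \<in> carrier_vec n" for x y
    using transpose_vec_mult_scalar[OF P(1) that(2) that(1)] that
    by (simp add: scalar_prod_def lessThan_atLeast0)
  have 3: "x \<bullet> y = (\<Sum>i<n. (transpose_mat P *\<^sub>v x) $ i * (transpose_mat P *\<^sub>v y) $ i)"
    if "x \<in> carrier_vec n" "y \<in> carrier_vec n" for x y
    using move[OF that(1), of "transpose_mat P *\<^sub>v y"] 1[OF that(2)] that Pt by simp
  have 4: "x \<bullet> (A *\<^sub>v x) = (\<Sum>i<n. f i * ((transpose_mat P *\<^sub>v x) $ i)\<^sup>2)" if x: "x \<in> carrier_vec n" for x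
  proof -
    let ?y = "transpose_mat P *\<^sub>v x"
    have y: "?y \<in> carrier_vec n" using Pt x by auto
    have D: "mat_diag n f *\<^sub>v ?y \<in> carrier_vec n"
      by (rule mult_mat_vec_carrier[OF mat_diag_dim y])
    have "A *\<^sub>v x = P *\<^sub>v (mat_diag n f *\<^sub>v ?y)"
      unfolding APf using P(1) Pt x y
      by (subst assoc_mult_mat_vec[of _ n n _ n]) (auto intro!: assoc_mult_mat_vec[of _ n n _ n])
    then have "x \<bullet> (A *\<^sub>v x) = (\<Sum>i<n. ?y $ i * (mat_diag n f *\<^sub>v ?y) $ i)"
      using move[OF x D] by simp
    also have "\<dots> = (\<Sum>i<n. f i * (?y $ i)\<^sup>2)"
    proof (intro sum.cong refl)
      fix i assume i: "i \<in> {..<n}"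
      have "(mat_diag n f *\<^sub>v ?y) $ i = (\<Sum>j<n. (if i = j then f j else 0) * ?y $ j)"
        using i y P by (simp add: mat_diag_def scalar_prod_def lessThan_atLeast0)
      also have "\<dots> = (\<Sum>j<n. if i = j then f j * ?y $ j else 0)" by (intro sum.cong) auto
      also have "\<dots> = f i * ?y $ i" using i by simp
      finally show "?y $ i * (mat_diag n f *\<^sub>v ?y) $ i = f i * (?y $ i)\<^sup>2"
        by (simp add: power2_eq_square)
    qed
    finally show ?thesis .
  qed
  have 5: "ith_eigenvalue A i = sort (map f [0..<n]) ! (i - 1)" for i
    unfolding ith_eigenvalue_def char_poly_orthogonally_diagonalized[OF P APf] proots_prod_linear_factors
    by (simp only: sorted_list_of_multiset_mset)
  have 6: "\<exists>x\<in>carrier_vec n. x \<bullet> (A *\<^sub>v x) = f i" if i: "i < n" for i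
  proof
    have e: "(unit_vec n i :: real vec) $ j = (if j = i then 1 else 0)" if "j < n" for j
      using that i by simp
    show c: "P *\<^sub>v unit_vec n i \<in> carrier_vec n" using P(1) by simp
    have "(P *\<^sub>v unit_vec n i) \<bullet> (A *\<^sub>v (P *\<^sub>v unit_vec n i)) = (\<Sum>j<n. f j * (unit_vec n i $ j)\<^sup>2)"
      unfolding 4[OF c] by (subst 2) auto
    also have "\<dots> = (\<Sum>j<n. if j = i then f j else 0)" by (intro sum.cong refl) (auto simp: e)
    also have "\<dots> = f i" using i by simp
    finally show "(P *\<^sub>v unit_vec n i) \<bullet> (A *\<^sub>v (P *\<^sub>v unit_vec n i)) = f i" .
  qed
  show thesis using that[OF P(1) 1 3 4 5 6] .
qed

lemma rayleigh_le_largest_eigenvalue: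
  assumes A: "A \<in> carrier_mat n n" "transpose_mat A = A" and x: "x \<in> carrier_vec n"
  shows "x \<bullet> (A *\<^sub>v x) \<le> ith_eigenvalue A n * (x \<bullet> x)"
proof (rule symmetric_mat_eigenbasis[OF A])
  fix f :: "nat \<Rightarrow> real" and P
  assume scal: "\<And>x y. x \<in> carrier_vec n \<Longrightarrow> y \<in> carrier_vec n \<Longrightarrow>
       x \<bullet> y = (\<Sum>i<n. (transpose_mat P *\<^sub>v x) $ i * (transpose_mat P *\<^sub>v y) $ i)"
    and quad: "\<And>x. x \<in> carrier_vec n \<Longrightarrow> x \<bullet> (A *\<^sub>v x) = (\<Sum>i<n. f i * ((transpose_mat P *\<^sub>v x) $ i)\<^sup>2)"
    and ith: "\<And>i. ith_eigenvalue A i = sort (map f [0..<n]) ! (i - 1)"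
  show ?thesis
    unfolding quad[OF x] scal[OF x x] ith sum_distrib_left power2_eq_square
    by (intro sum_mono mult_right_mono le_last_sort_map) auto
qed

lemma psd_eigenvalue_nonneg:
  assumes A: "A \<in> carrier_mat n n" "transpose_mat A = A"
    and psd: "\<And>x. x \<in> carrier_vec n \<Longrightarrow> 0 \<le> x \<bullet> (A *\<^sub>v x)"
    and "1 \<le> i" "i \<le> n"
  shows "0 \<le> ith_eigenvalue A i"
proof (rule symmetric_mat_eigenbasis[OF A])
  fix f :: "nat \<Rightarrow> real"
  assume ith: "\<And>i. ith_eigenvalue A i = sort (map f [0..<n]) ! (i - 1)"
    and fex: "\<And>i. i < n \<Longrightarrow> \<exists>x\<in>carrier_vec n. x \<bullet> (A *\<^sub>v x) = f i"
  have "0 \<le> f j" if "j < n" for j using fex[OF that] psd by force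
  moreover have "sort (map f [0..<n]) ! (i - 1) \<in> set (sort (map f [0..<n]))"
    using assms(4,5) by (intro nth_mem) auto
  ultimately show ?thesis unfolding ith by auto
qed

text \<open>The coordinates of the kernel vector \<open>z\<close> are supported where
  \<open>f\<close> vanishes. Since the second eigenvalue is positive, this is a single index
  \<open>k\<close>, so orthogonality to \<open>z\<close> kills the \<open>k\<close>-th coordinate of
  \<open>x\<close>; at all other indices \<open>f\<close> is at least the second eigenvalue.\<close>

lemma psd_rayleigh_ge_second_eigenvalue:
  assumes A: "A \<in> carrier_mat n n" "transpose_mat A = A"
    and psd: "\<And>x. x \<in> carrier_vec n \<Longrightarrow> 0 \<le> x \<bullet> (A *\<^sub>v x)"
    and z: "z \<in> carrier_vec n" "z \<noteq> 0\<^sub>v n" "A *\<^sub>v z = 0\<^sub>v n"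
    and pos: "0 < ith_eigenvalue A 2"
    and x: "x \<in> carrier_vec n" "x \<bullet> z = 0"
  shows "ith_eigenvalue A 2 * (x \<bullet> x) \<le> x \<bullet> (A *\<^sub>v x)"
proof (rule symmetric_mat_eigenbasis[OF A])
  fix f :: "nat \<Rightarrow> real" and P
  assume P: "P \<in> carrier_mat n n" "\<And>x. x \<in> carrier_vec n \<Longrightarrow> P *\<^sub>v (transpose_mat P *\<^sub>v x) = x"
    and scal: "\<And>x y. x \<in> carrier_vec n \<Longrightarrow> y \<in> carrier_vec n \<Longrightarrow>
       x \<bullet> y = (\<Sum>i<n. (transpose_mat P *\<^sub>v x) $ i * (transpose_mat P *\<^sub>v y) $ i)"
    and quad: "\<And>x. x \<in> carrier_vec n \<Longrightarrow> x \<bullet> (A *\<^sub>v x) = (\<Sum>i<n. f i * ((transpose_mat P *\<^sub>v x) $ i)\<^sup>2)"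
    and ith: "\<And>i. ith_eigenvalue A i = sort (map f [0..<n]) ! (i - 1)"
    and fex: "\<And>i. i < n \<Longrightarrow> \<exists>x\<in>carrier_vec n. x \<bullet> (A *\<^sub>v x) = f i"
  have f: "0 \<le> f j" if "j < n" for j using fex[OF that] psd by force
  define w where "w = transpose_mat P *\<^sub>v z"
  define y where "y = transpose_mat P *\<^sub>v x"
  have w: "w \<in> carrier_vec n" using P z by (simp add: w_def)
  have "z \<bullet> (A *\<^sub>v z) = 0" using z by simp
  then have "(\<Sum>i<n. f i * (w $ i)\<^sup>2) = 0" using quad[OF z(1)] by (simp add: w_def)
  then have fw: "f i = 0 \<or> w $ i = 0" if "i < n" for i
    using that f by (subst (asm) sum_nonneg_eq_0_iff) auto
  have "w \<noteq> 0\<^sub>v n"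
    using P(2)[OF z(1)] z(2) P(1) unfolding w_def[symmetric] by auto
  then obtain k where k: "k < n" "w $ k \<noteq> 0" using w by (metis carrier_vecD eq_vecI index_zero_vec)
  then have fk: "f k = 0" using fw by auto
  have ge: "ith_eigenvalue A 2 \<le> f i" if "i < n" "i \<noteq> k" for i
    using sort_map_nth_1_le[of k n i f] that k fk pos ith[of 2] by simp
  then have w0: "w $ i = 0" if "i < n" "i \<noteq> k" for i using fw[of i] that pos by force
  have "x \<bullet> z = (\<Sum>i<n. y $ i * w $ i)" using scal[OF x(1) z(1)] by (simp add: y_def w_def)
  also have "\<dots> = (\<Sum>i<n. if i = k then y $ k * w $ k else 0)" by (intro sum.cong) (auto simp: w0)
  also have "\<dots> = y $ k * w $ k" using k by simp
  finally have yk: "y $ k = 0" using x k by simp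
  have "ith_eigenvalue A 2 * (x \<bullet> x) = (\<Sum>i<n. ith_eigenvalue A 2 * (y $ i)\<^sup>2)"
    using scal[OF x(1) x(1)] by (simp add: y_def power2_eq_square sum_distrib_left)
  also have "\<dots> \<le> (\<Sum>i<n. f i * (y $ i)\<^sup>2)"
  proof (rule sum_mono)
    fix i assume "i \<in> {..<n}"
    then show "ith_eigenvalue A 2 * (y $ i)\<^sup>2 \<le> f i * (y $ i)\<^sup>2"
      using ge[of i] yk by (cases "i = k") (auto intro: mult_right_mono)
  qed
  also have "\<dots> = x \<bullet> (A *\<^sub>v x)" using quad[OF x(1)] by (simp add: y_def)
  finally show ?thesis .
qed

section \<open>The Dirichlet form of a graph\<close>

text \<open>The quadratic form of the Laplacian, free of any enumeration of the vertices. The sum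
  runs over ordered pairs, hence the division by 2.\<close>

definition dirichlet :: "'a set \<Rightarrow> 'a set set \<Rightarrow> ('a \<Rightarrow> real) \<Rightarrow> real" where
  "dirichlet V E f = (\<Sum>x\<in>V. \<Sum>y\<in>V. if {x, y} \<in> E then (f x - f y)\<^sup>2 else 0) / 2"

text \<open>The squared norm of \<open>f\<close> minus its mean. Stating the spectral bounds with it
  admits test functions whose sum is not zero.\<close>

definition centered_norm :: "'a set \<Rightarrow> ('a \<Rightarrow> real) \<Rightarrow> real" where
  "centered_norm V f = (\<Sum>x\<in>V. (f x)\<^sup>2) - (\<Sum>x\<in>V. f x)\<^sup>2 / real (card V)"

lemma dirichlet_nonneg: "0 \<le> dirichlet V E f"
  unfolding dirichlet_def by (simp add: sum_nonneg)

lemma simple_graph_vertex_degree: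
  assumes "simple_graph V E" "x \<in> V"
  shows "real (vertex_degree E x) = (\<Sum>y\<in>V. if {x, y} \<in> E then 1 else 0)"
proof -
  have fin: "finite V" and E: "\<And>e. e \<in> E \<Longrightarrow> e \<subseteq> V \<and> card e = 2"
    using assms(1) by (auto simp: simple_graph_def)
  have "{e \<in> E. x \<in> e} = (\<lambda>y. {x, y}) ` {y \<in> V. {x, y} \<in> E}"
  proof (intro equalityI subsetI)
    fix e assume e: "e \<in> {e \<in> E. x \<in> e}"
    then have "card e = 2" using E by blast
    then obtain p q where "e = {p, q}" unfolding card_2_iff by blast
    then obtain y where "e = {x, y}" using e by auto
    then show "e \<in> (\<lambda>y. {x, y}) ` {y \<in> V. {x, y} \<in> E}" using e E by auto
  qed auto
  moreover have "inj_on (\<lambda>y. {x, y}) {y \<in> V. {x, y} \<in> E}"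
    by (rule inj_onI) (auto simp: doubleton_eq_iff)
  ultimately have "vertex_degree E x = card {y \<in> V. {x, y} \<in> E}"
    unfolding vertex_degree_def by (simp add: card_image)
  also have "real \<dots> = (\<Sum>y\<in>V. if {x, y} \<in> E then 1 else 0)"
    using sum.inter_filter[OF fin, of "\<lambda>_. 1 :: real" "\<lambda>y. {x, y} \<in> E"] by simp
  finally show ?thesis .
qed

lemma dirichlet_eq:
  assumes "simple_graph V E"
  shows "dirichlet V E f = (\<Sum>x\<in>V. f x * (real (vertex_degree E x) * f x - (\<Sum>y\<in>V. if {x, y} \<in> E then f y else 0)))"
proof -
  define a where "a x y = (if {x, y} \<in> E then 1 else 0 :: real)" for x y
  have a_sym: "a x y = a y x" for x y by (simp add: a_def insert_commute)
  have deg: "real (vertex_degree E x) = (\<Sum>y\<in>V. a x y)" if "x \<in> V" for x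
    using simple_graph_vertex_degree[OF assms that] by (simp add: a_def)
  have nb: "(\<Sum>y\<in>V. if {x, y} \<in> E then f y else 0) = (\<Sum>y\<in>V. a x y * f y)" for x
    by (intro sum.cong) (auto simp: a_def)
  have "(if {x, y} \<in> E then (f x - f y)\<^sup>2 else 0) =
      a x y * (f x)\<^sup>2 + a x y * (f y)\<^sup>2 - 2 * (a x y * f x * f y)" for x y
    by (simp add: a_def power2_diff)
  then have "2 * dirichlet V E f = (\<Sum>x\<in>V. \<Sum>y\<in>V. a x y * (f x)\<^sup>2) + (\<Sum>x\<in>V. \<Sum>y\<in>V. a x y * (f y)\<^sup>2)
      - 2 * (\<Sum>x\<in>V. \<Sum>y\<in>V. a x y * f x * f y)"
    unfolding dirichlet_def by (simp only: sum.distrib sum_subtractf sum_distrib_left) simp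
  also have "(\<Sum>x\<in>V. \<Sum>y\<in>V. a x y * (f y)\<^sup>2) = (\<Sum>x\<in>V. \<Sum>y\<in>V. a x y * (f x)\<^sup>2)"
    by (subst sum.swap, subst a_sym) (rule refl)
  finally have "dirichlet V E f = (\<Sum>x\<in>V. \<Sum>y\<in>V. a x y * (f x)\<^sup>2) - (\<Sum>x\<in>V. \<Sum>y\<in>V. a x y * f x * f y)"
    by simp
  also have "\<dots> = (\<Sum>x\<in>V. f x * ((\<Sum>y\<in>V. a x y) * f x - (\<Sum>y\<in>V. a x y * f y)))"
    unfolding sum_subtractf[symmetric]
    by (simp add: sum_distrib_left sum_distrib_right sum_subtractf right_diff_distrib power2_eq_square mult_ac)
  also have "\<dots> = (\<Sum>x\<in>V. f x * (real (vertex_degree E x) * f x - (\<Sum>y\<in>V. if {x, y} \<in> E then f y else 0)))"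
    by (intro sum.cong refl) (simp add: deg nb)
  finally show ?thesis .
qed

section \<open>The Laplacian matrix represents the Dirichlet form\<close>

lemma laplacian_mat_carrier: "laplacian_mat n v E \<in> carrier_mat n n"
  unfolding laplacian_mat_def degree_mat_def adjacency_mat_def by (rule minus_carrier_mat) simp

lemma laplacian_mat_symmetric: "transpose_mat (laplacian_mat n v E) = laplacian_mat n v E"
proof (rule eq_matI)
  fix i j assume "i < dim_row (laplacian_mat n v E)" "j < dim_col (laplacian_mat n v E)"
  then have ij: "i < n" "j < n" using laplacian_mat_carrier[of n v E] by auto
  have "{v i, v j} = {v j, v i}" by blast
  then show "transpose_mat (laplacian_mat n v E) $$ (i, j) = laplacian_mat n v E $$ (i, j)"
    using ij by (simp add: laplacian_mat_def degree_mat_def adjacency_mat_def)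
qed (use laplacian_mat_carrier[of n v E] in auto)

lemma laplacian_mat_mult_vec:
  assumes bij: "bij_betw v {..<n} V" and i: "i < n"
  shows "(laplacian_mat n v E *\<^sub>v vec n (\<lambda>i. f (v i))) $ i =
    real (vertex_degree E (v i)) * f (v i) - (\<Sum>y\<in>V. if {v i, y} \<in> E then f y else 0)"
proof -
  have "(laplacian_mat n v E *\<^sub>v vec n (\<lambda>i. f (v i))) $ i =
     (\<Sum>j<n. ((if i = j then real (vertex_degree E (v i)) else 0) - (if {v i, v j} \<in> E then 1 else 0)) * f (v j))"
    using i by (simp add: laplacian_mat_def degree_mat_def adjacency_mat_def scalar_prod_def lessThan_atLeast0)
  also have "\<dots> = (\<Sum>j<n. (if i = j then real (vertex_degree E (v i)) * f (v i) else 0))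
      - (\<Sum>j<n. if {v i, v j} \<in> E then f (v j) else 0)"
    unfolding sum_subtractf[symmetric] by (intro sum.cong) (auto simp: left_diff_distrib)
  also have "(\<Sum>j<n. if {v i, v j} \<in> E then f (v j) else 0) = (\<Sum>y\<in>V. if {v i, y} \<in> E then f y else 0)"
    by (rule sum.reindex_bij_betw[OF bij])
  finally show ?thesis using i by simp
qed

lemma laplacian_mat_quadratic_form:
  assumes "simple_graph V E" and bij: "bij_betw v {..<n} V"
  shows "vec n (\<lambda>i. f (v i)) \<bullet> (laplacian_mat n v E *\<^sub>v vec n (\<lambda>i. f (v i))) = dirichlet V E f"
proof -
  let ?L = "laplacian_mat n v E *\<^sub>v vec n (\<lambda>i. f (v i))"
  have "dim_vec ?L = n" using laplacian_mat_carrier[of n v E] by simp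
  then have "vec n (\<lambda>i. f (v i)) \<bullet> ?L = (\<Sum>i<n. f (v i) * ?L $ i)"
    by (simp add: scalar_prod_def lessThan_atLeast0)
  also have "\<dots> = (\<Sum>i<n. f (v i) * (real (vertex_degree E (v i)) * f (v i) - (\<Sum>y\<in>V. if {v i, y} \<in> E then f y else 0)))"
    by (intro sum.cong refl) (simp add: laplacian_mat_mult_vec[OF bij])
  also have "\<dots> = dirichlet V E f"
    unfolding dirichlet_eq[OF assms(1)] by (rule sum.reindex_bij_betw[OF bij])
  finally show ?thesis .
qed

lemma laplacian_mat_psd:
  assumes "simple_graph V E" "bij_betw v {..<n} V" "x \<in> carrier_vec n"
  shows "0 \<le> x \<bullet> (laplacian_mat n v E *\<^sub>v x)"
proof -
  define f where "f a = x $ the_inv_into {..<n} v a" for a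
  have "vec n (\<lambda>i. f (v i)) = x"
    using assms(3) by (intro eq_vecI) (auto simp: f_def the_inv_into_f_f bij_betw_imp_inj_on[OF assms(2)])
  then show ?thesis
    using laplacian_mat_quadratic_form[OF assms(1,2), of f] dirichlet_nonneg[of V E f] by simp
qed

text \<open>Both forms ignore additive constants, so \<open>f\<close> may be replaced by its
  mean-free part \<open>g\<close>. The lower bound holds because \<open>g\<close> is orthogonal to
  the all-ones kernel vector; the upper bound gains from the shift, as \<open>g\<close> has the
  smallest norm among all translates of \<open>f\<close>.\<close>

lemma laplacian_mat_eigenvalue_bounds:
  assumes G: "simple_graph V E" and bij: "bij_betw v {..<n} V" and "n > 0"
    and pos: "0 < ith_eigenvalue (laplacian_mat n v E) 2"
  shows "ith_eigenvalue (laplacian_mat n v E) 2 * centered_norm V f \<le> dirichlet V E f"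
    and "dirichlet V E f \<le> ith_eigenvalue (laplacian_mat n v E) n * centered_norm V f"
proof -
  have n: "card V = n" using bij_betw_same_card[OF bij] by simp
  define c where "c = (\<Sum>x\<in>V. f x) / real n"
  define g where "g x = f x - c" for x
  define x where "x = vec n (\<lambda>i. g (v i))"
  define e where "e = vec n (\<lambda>i. 1 :: real)"
  have x: "x \<in> carrier_vec n" and e: "e \<in> carrier_vec n" by (auto simp: x_def e_def)
  have "(\<Sum>x\<in>V. g x) = 0" using \<open>n > 0\<close> by (simp add: g_def sum_subtractf n c_def)
  then have xe: "x \<bullet> e = 0"
    by (simp add: x_def e_def scalar_prod_def flip: lessThan_atLeast0)
      (simp add: sum.reindex_bij_betw[OF bij])
  have "x \<bullet> x = (\<Sum>i<n. (g (v i))\<^sup>2)"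
    by (simp add: x_def scalar_prod_def power2_eq_square lessThan_atLeast0)
  also have "\<dots> = (\<Sum>a\<in>V. (g a)\<^sup>2)" by (rule sum.reindex_bij_betw[OF bij])
  also have "\<dots> = (\<Sum>a\<in>V. (f a)\<^sup>2) - 2 * c * (\<Sum>a\<in>V. f a) + n * c\<^sup>2"
    unfolding sum_distrib_left
    by (simp add: g_def power2_diff sum.distrib sum_subtractf n mult_ac)
  also have "\<dots> = centered_norm V f"
    using \<open>n > 0\<close> by (simp add: centered_norm_def c_def n field_simps power2_eq_square)
  finally have xx: "x \<bullet> x = centered_norm V f" .
  have xLx: "x \<bullet> (laplacian_mat n v E *\<^sub>v x) = dirichlet V E f"
    unfolding x_def laplacian_mat_quadratic_form[OF G bij] by (simp add: dirichlet_def g_def cong: if_cong)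
  have "laplacian_mat n v E *\<^sub>v e = 0\<^sub>v n"
  proof (rule eq_vecI)
    fix i assume "i < dim_vec (0\<^sub>v n :: real vec)"
    then have i: "i < n" by simp
    then have "v i \<in> V" using bij by (auto simp: bij_betw_def)
    then show "(laplacian_mat n v E *\<^sub>v e) $ i = 0\<^sub>v n $ i"
      using laplacian_mat_mult_vec[OF bij i, of E "\<lambda>_. 1"] i
      by (simp add: e_def simple_graph_vertex_degree[OF G])
  qed (use laplacian_mat_carrier[of n v E] in simp)
  moreover have "e \<noteq> 0\<^sub>v n"
    using \<open>n > 0\<close> by (auto simp: e_def vec_eq_iff)
  ultimately show "ith_eigenvalue (laplacian_mat n v E) 2 * centered_norm V f \<le> dirichlet V E f"
    using psd_rayleigh_ge_second_eigenvalue[OF laplacian_mat_carrier laplacian_mat_symmetric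
        laplacian_mat_psd[OF G bij] e _ _ pos x xe] xx xLx by simp
  show "dirichlet V E f \<le> ith_eigenvalue (laplacian_mat n v E) n * centered_norm V f"
    using rayleigh_le_largest_eigenvalue[OF laplacian_mat_carrier laplacian_mat_symmetric x, of v E] xx xLx
    by simp
qed

section \<open>Nonadjacent parts and the spectrum\<close>

text \<open>Greedy distribution: putting each new weight on the lighter side keeps the imbalance at
  most \<open>M\<close>.\<close>

lemma balanced_subset:
  fixes w :: "'b \<Rightarrow> real"
  assumes "finite I" "0 \<le> M" "\<And>i. i \<in> I \<Longrightarrow> 0 \<le> w i \<and> w i \<le> M"
  shows "\<exists>A\<subseteq>I. \<bar>sum w A - sum w (I - A)\<bar> \<le> M"
  using assms(1,3)
proof (induction I rule: finite_induct)
  case empty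
  then show ?case using \<open>0 \<le> M\<close> by simp
next
  case (insert i I)
  then obtain A where A: "A \<subseteq> I" "\<bar>sum w A - sum w (I - A)\<bar> \<le> M" by blast
  then have fin: "finite A" "i \<notin> A" using insert.hyps finite_subset by auto
  have i: "0 \<le> w i" "w i \<le> M" using insert.prems by auto
  show ?case
  proof (cases "sum w A \<le> sum w (I - A)")
    case True
    have "insert i I - insert i A = I - A" using insert.hyps by auto
    then show ?thesis
      using A fin i True by (intro exI[of _ "insert i A"]) auto
  next
    case False
    have "insert i I - A = insert i (I - A)" using fin by auto
    then have "sum w (insert i I - A) = w i + sum w (I - A)" using insert.hyps by simp
    then show ?thesis
      using A i False by (intro exI[of _ A]) auto
  qed
qed

text \<open>If some \<open>d j\<close> is below \<open>a\<close>, every other value exceeds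
  \<open>a\<close> by at least the same deficit, and there is at least one other value to
  compensate.\<close>

lemma sum_ge_of_pairs:
  fixes d :: "'b \<Rightarrow> real"
  assumes "finite I" "card I \<ge> 2"
    and pair: "\<And>i j. i \<in> I \<Longrightarrow> j \<in> I \<Longrightarrow> i \<noteq> j \<Longrightarrow> 2 * a \<le> d i + d j"
  shows "a * real (card I) \<le> sum d I"
proof (cases "\<forall>i\<in>I. a \<le> d i")
  case True
  then show ?thesis using sum_mono[of I "\<lambda>_. a" d] by (simp add: mult.commute)
next
  case False
  then obtain j where j: "j \<in> I" "d j < a" by auto
  have "(2 * a - d j) * real (card I - 1) = (\<Sum>i\<in>I - {j}. 2 * a - d j)"
    using j assms(1) by simp
  also have "\<dots> \<le> sum d (I - {j})"
  proof (rule sum_mono)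
    fix i assume "i \<in> I - {j}"
    then show "2 * a - d j \<le> d i" using pair[of i j] j by auto
  qed
  finally have "d j + (2 * a - d j) * (real (card I) - 1) \<le> sum d I"
    using assms(1,2) j by (simp add: sum.remove[of I j] of_nat_diff)
  moreover have "0 \<le> (a - d j) * (real (card I) - 2)" using j assms(2) by simp
  ultimately show ?thesis by (simp add: algebra_simps)
qed

lemma sum_two_valued:
  assumes "finite V" "X \<subseteq> V" "Y \<subseteq> V" "X \<inter> Y = {}"
  shows "(\<Sum>u\<in>V. (if u \<in> X then \<alpha> else if u \<in> Y then \<beta> else 0)) = \<alpha> * real (card X) + \<beta> * real (card Y)"
    and "(\<Sum>u\<in>V. (if u \<in> X then \<alpha> else if u \<in> Y then \<beta> else 0)\<^sup>2) = \<alpha>\<^sup>2 * real (card X) + \<beta>\<^sup>2 * real (card Y)"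
proof -
  have *: "(\<Sum>u\<in>V. (if u \<in> X then \<alpha> else if u \<in> Y then \<beta> else 0)) = \<alpha> * real (card X) + \<beta> * real (card Y)"
    for \<alpha> \<beta> :: real
  proof -
    have "(\<Sum>u\<in>V. (if u \<in> X then \<alpha> else if u \<in> Y then \<beta> else 0)) =
        (\<Sum>u\<in>X \<union> Y. (if u \<in> X then \<alpha> else if u \<in> Y then \<beta> else 0))"
      using assms by (intro sum.mono_neutral_right) auto
    also have "\<dots> = (\<Sum>u\<in>X. if u \<in> X then \<alpha> else if u \<in> Y then \<beta> else 0) +
        (\<Sum>u\<in>Y. if u \<in> X then \<alpha> else if u \<in> Y then \<beta> else 0)"
      using assms finite_subset[of X V] finite_subset[of Y V] by (intro sum.union_disjoint) auto
    also have "(\<Sum>u\<in>X. if u \<in> X then \<alpha> else if u \<in> Y then \<beta> else 0) = (\<Sum>u\<in>X. \<alpha>)"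
      by (intro sum.cong) auto
    also have "(\<Sum>u\<in>Y. if u \<in> X then \<alpha> else if u \<in> Y then \<beta> else 0) = (\<Sum>u\<in>Y. \<beta>)"
      using assms(4) by (intro sum.cong) auto
    finally show ?thesis by (simp add: mult.commute)
  qed
  show "(\<Sum>u\<in>V. (if u \<in> X then \<alpha> else if u \<in> Y then \<beta> else 0)) = \<alpha> * real (card X) + \<beta> * real (card Y)"
    by (rule *)
  have "(\<Sum>u\<in>V. (if u \<in> X then \<alpha> else if u \<in> Y then \<beta> else 0)\<^sup>2) =
      (\<Sum>u\<in>V. (if u \<in> X then \<alpha>\<^sup>2 else if u \<in> Y then \<beta>\<^sup>2 else 0))" by (intro sum.cong) auto
  then show "(\<Sum>u\<in>V. (if u \<in> X then \<alpha> else if u \<in> Y then \<beta> else 0)\<^sup>2) = \<alpha>\<^sup>2 * real (card X) + \<beta>\<^sup>2 * real (card Y)"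
    by (simp add: *)
qed

text \<open>Changing the sign of \<open>f\<close> on one of two mutually nonadjacent sets preserves the Dirichlet form
  but not the mean of \<open>f\<close>; comparing the two spectral bounds gives the estimate.\<close>

lemma nonadjacent_sets_bound:
  assumes "finite V"
    and lower: "\<And>f. a * centered_norm V f \<le> dirichlet V E f"
    and upper: "\<And>f. dirichlet V E f \<le> b * centered_norm V f"
    and ab: "m * b < (m + 1) * a" "0 < b" "0 \<le> (m :: real)"
    and XY: "X \<subseteq> V" "Y \<subseteq> V" "X \<inter> Y = {}" "X \<noteq> {}" "Y \<noteq> {}"
    and nonadj: "\<And>x y. x \<in> X \<Longrightarrow> y \<in> Y \<Longrightarrow> {x, y} \<notin> E"
  shows "4 * m * (m + 1) * real (card X) * real (card Y) <
    real (card V) * (real (card V) - real (card X) - real (card Y))"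
proof -
  define x y n where "x = real (card X)" and "y = real (card Y)" and "n = real (card V)"
  have fin: "finite X" "finite Y" using XY(1,2) \<open>finite V\<close> by (auto intro: finite_subset)
  have pos: "0 < x" "0 < y" using XY fin by (auto simp: x_def y_def card_gt_0_iff)
  have "card X + card Y \<le> card V"
    using card_mono[of V "X \<union> Y"] card_Un_disjoint[OF fin XY(3)] XY \<open>finite V\<close> by simp
  then have xyn: "x + y \<le> n" by (simp add: x_def y_def n_def flip: of_nat_add)
  \<comment> \<open>The weights make \<open>\<alpha>\<^sup>2 * x * (n - x)\<close> and
    \<open>\<beta>\<^sup>2 * y * (n - y)\<close> equal (both are \<open>R\<^sup>2\<close>). By the
    inequality of arithmetic and geometric means this maximizes the ratio of the two centered norms
    compared below.\<close>
  define \<alpha> where "\<alpha> = sqrt (y * (n - y))"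
  define \<beta> where "\<beta> = sqrt (x * (n - x))"
  have \<alpha>: "\<alpha>\<^sup>2 = y * (n - y)" "0 < \<alpha>" and \<beta>: "\<beta>\<^sup>2 = x * (n - x)" "0 < \<beta>"
    using pos xyn by (auto simp: \<alpha>_def \<beta>_def)
  define R where "R = \<alpha> * \<beta>"
  have R: "0 < R" "R\<^sup>2 = x * y * (n - x) * (n - y)"
    using \<alpha> \<beta> by (auto simp: R_def power_mult_distrib)
  define h where "h \<gamma> u = (if u \<in> X then \<alpha> else if u \<in> Y then \<gamma> else 0)" for \<gamma> u
  have "n > 0" using pos xyn by simp
  have cn: "n * centered_norm V (h \<gamma>) = n * (\<alpha>\<^sup>2 * x + \<gamma>\<^sup>2 * y) - (\<alpha> * x + \<gamma> * y)\<^sup>2" for \<gamma>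
    unfolding centered_norm_def h_def sum_two_valued[OF \<open>finite V\<close> XY(1-3)]
    using \<open>n > 0\<close> unfolding x_def[symmetric] y_def[symmetric] n_def[symmetric]
    by (simp add: right_diff_distrib)
  have nonadj': "{u, v} \<notin> E" if "u \<in> Y" "v \<in> X" for u v
    using nonadj[OF that(2,1)] by (simp add: insert_commute)
  \<comment> \<open>Only pairs between \<open>X\<close> and \<open>Y\<close> could notice the sign,
    and they carry no edges; inside \<open>Y\<close>, or from \<open>Y\<close> to the zero set,
    differences at most change sign.\<close>
  have "dirichlet V E (h (- \<beta>)) = dirichlet V E (h \<beta>)"
    unfolding dirichlet_def
    by (intro arg_cong[where f = "\<lambda>z. z / 2"] sum.cong refl)
      (use nonadj nonadj' XY(3) in \<open>auto simp: h_def power2_commute\<close>)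
  then have "a * centered_norm V (h (- \<beta>)) \<le> b * centered_norm V (h \<beta>)"
    using lower[of "h (- \<beta>)"] upper[of "h \<beta>"] by simp
  then have "n * (a * centered_norm V (h (- \<beta>))) \<le> n * (b * centered_norm V (h \<beta>))"
    using \<open>n > 0\<close> by simp
  then have "a * (n * centered_norm V (h (- \<beta>))) \<le> b * (n * centered_norm V (h \<beta>))"
    by (simp add: mult.left_commute)
  moreover have "n * centered_norm V (h (- \<beta>)) = 2 * R * (R + x * y)"
  proof -
    have "n * centered_norm V (h (- \<beta>)) = \<alpha>\<^sup>2 * x * (n - x) + \<beta>\<^sup>2 * y * (n - y) + 2 * R * (x * y)"
      unfolding cn by (simp add: R_def power2_eq_square algebra_simps)
    also have "\<alpha>\<^sup>2 * x * (n - x) + \<beta>\<^sup>2 * y * (n - y) = 2 * R\<^sup>2"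
      unfolding R(2) \<alpha> \<beta> by (simp add: algebra_simps)
    finally show ?thesis by (simp add: power2_eq_square algebra_simps)
  qed
  moreover have "n * centered_norm V (h \<beta>) = 2 * R * (R - x * y)"
  proof -
    have "n * centered_norm V (h \<beta>) = \<alpha>\<^sup>2 * x * (n - x) + \<beta>\<^sup>2 * y * (n - y) - 2 * R * (x * y)"
      unfolding cn by (simp add: R_def power2_eq_square algebra_simps)
    also have "\<alpha>\<^sup>2 * x * (n - x) + \<beta>\<^sup>2 * y * (n - y) = 2 * R\<^sup>2"
      unfolding R(2) \<alpha> \<beta> by (simp add: algebra_simps)
    finally show ?thesis by (simp add: power2_eq_square algebra_simps)
  qed
  ultimately have "(2 * R) * (a * (R + x * y)) \<le> (2 * R) * (b * (R - x * y))"
    by (simp add: mult_ac)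
  then have "a * (R + x * y) \<le> b * (R - x * y)" using R(1) by simp
  then have "(m + 1) * (a * (R + x * y)) \<le> (m + 1) * (b * (R - x * y))"
    using ab(3) by (intro mult_left_mono) auto
  moreover have "m * b * (R + x * y) < (m + 1) * a * (R + x * y)"
    using ab(1) R(1) pos by (intro mult_strict_right_mono) (auto intro: add_pos_pos)
  ultimately have "b * (m * (R + x * y)) < b * ((m + 1) * (R - x * y))"
    by (simp add: mult_ac)
  then have "m * (R + x * y) < (m + 1) * (R - x * y)" using ab(2) by simp
  then have "(2 * m + 1) * (x * y) < R" by (simp add: algebra_simps)
  then have "((2 * m + 1) * (x * y))\<^sup>2 < R\<^sup>2"
    using ab(3) pos by (intro power_strict_mono) auto
  then have "(x * y) * ((2 * m + 1)\<^sup>2 * (x * y)) < (x * y) * ((n - x) * (n - y))"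
    unfolding R(2) by (simp add: power2_eq_square mult_ac)
  then have "(2 * m + 1)\<^sup>2 * (x * y) < (n - x) * (n - y)" using pos by simp
  \<comment> \<open>Subtracting xy from both sides: (2m+1)^2 - 1 = 4m(m+1) and (n-x)(n-y) - xy =
    n(n-x-y).\<close>
  then show ?thesis
    unfolding x_def[symmetric] y_def[symmetric] n_def[symmetric]
    by (simp add: power2_eq_square algebra_simps)
qed

text \<open>Neighbours of a vertex of \<open>I\<close> lie outside \<open>I\<close>, where
  \<open>f\<close> vanishes, so only the degree part of the Laplacian survives.\<close>

lemma dirichlet_independent_support:
  assumes "simple_graph V E" "I \<subseteq> V"
    and indep: "\<And>x y. x \<in> I \<Longrightarrow> y \<in> I \<Longrightarrow> {x, y} \<notin> E"
    and supp: "\<And>x. x \<notin> I \<Longrightarrow> f x = 0"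
  shows "dirichlet V E f = (\<Sum>x\<in>I. real (vertex_degree E x) * (f x)\<^sup>2)"
proof -
  have "finite V" using assms(1) by (simp add: simple_graph_def)
  have "dirichlet V E f = (\<Sum>x\<in>I. f x * (real (vertex_degree E x) * f x - (\<Sum>y\<in>V. if {x, y} \<in> E then f y else 0)))"
    unfolding dirichlet_eq[OF assms(1)]
    by (rule sum.mono_neutral_right) (use \<open>finite V\<close> assms(2) supp in auto)
  also have "\<dots> = (\<Sum>x\<in>I. real (vertex_degree E x) * (f x)\<^sup>2)"
  proof (intro sum.cong refl)
    fix x assume x: "x \<in> I"
    have "(\<Sum>y\<in>V. if {x, y} \<in> E then f y else 0) = 0"
      using indep[OF x] supp by (intro sum.neutral) auto
    then show "f x * (real (vertex_degree E x) * f x - (\<Sum>y\<in>V. if {x, y} \<in> E then f y else 0)) =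
        real (vertex_degree E x) * (f x)\<^sup>2" by (simp add: power2_eq_square)
  qed
  finally show ?thesis .
qed

text \<open>A Hoffman-type bound, by estimating the degree sum over \<open>I\<close> from both
  sides. Differences of two indicators have mean zero and give average degree at least
  \<open>a\<close>; a single indicator would lose a factor 1 - 1/n. The indicator of
  \<open>I\<close> gives the upper estimate.\<close>

lemma independent_set_bound:
  assumes G: "simple_graph V E"
    and lower: "\<And>f. a * centered_norm V f \<le> dirichlet V E f"
    and upper: "\<And>f. dirichlet V E f \<le> b * centered_norm V f"
    and I: "I \<subseteq> V" "card I \<ge> 2"
    and indep: "\<And>x y. x \<in> I \<Longrightarrow> y \<in> I \<Longrightarrow> {x, y} \<notin> E"
  shows "a * real (card V) \<le> b * (real (card V) - real (card I))"
proof -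
  have "finite V" using G by (simp add: simple_graph_def)
  then have "finite I" using I finite_subset by auto
  have n: "0 < real (card V)" "0 < real (card I)"
    using I card_mono[OF \<open>finite V\<close> I(1)] by auto
  let ?d = "\<lambda>x. real (vertex_degree E x)"
  have "2 * a \<le> ?d i + ?d j" if ij: "i \<in> I" "j \<in> I" "i \<noteq> j" for i j
  proof -
    define f where "f u = (if u \<in> {i} then 1 else if u \<in> {j} then - 1 else 0 :: real)" for u
    have "{i} \<subseteq> V" "{j} \<subseteq> V" "{i} \<inter> {j} = {}" using ij I by auto
    note s = sum_two_valued[OF \<open>finite V\<close> this]
    have cn: "centered_norm V f = 2" unfolding centered_norm_def f_def s by simp
    have "dirichlet V E f = (\<Sum>x\<in>I. ?d x * (f x)\<^sup>2)"
      by (rule dirichlet_independent_support[OF G I(1) indep]) (use ij in \<open>auto simp: f_def\<close>)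
    also have "\<dots> = (\<Sum>x\<in>{i, j}. ?d x * (f x)\<^sup>2)"
      by (rule sum.mono_neutral_right) (use \<open>finite I\<close> ij in \<open>auto simp: f_def\<close>)
    also have "\<dots> = ?d i + ?d j" using ij by (simp add: f_def)
    finally show ?thesis using lower[of f] cn by simp
  qed
  then have "a * real (card I) \<le> (\<Sum>x\<in>I. ?d x)" by (rule sum_ge_of_pairs[OF \<open>finite I\<close> I(2)])
  also have "(\<Sum>x\<in>I. ?d x) \<le> b * (real (card I) - (real (card I))\<^sup>2 / real (card V))"
  proof -
    define f where "f u = (if u \<in> I then 1 else if u \<in> {} then 0 else 0 :: real)" for u
    have cn: "centered_norm V f = real (card I) - (real (card I))\<^sup>2 / real (card V)"
      unfolding centered_norm_def f_def
        sum_two_valued[OF \<open>finite V\<close> I(1) empty_subsetI Int_empty_right] by simp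
    have "dirichlet V E f = (\<Sum>x\<in>I. ?d x * (f x)\<^sup>2)"
      by (rule dirichlet_independent_support[OF G I(1) indep]) (auto simp: f_def)
    also have "\<dots> = (\<Sum>x\<in>I. ?d x)" by (intro sum.cong) (auto simp: f_def)
    finally show ?thesis using upper[of f] cn by simp
  qed
  finally have "real (card I) * (a * real (card V)) \<le> real (card I) * (b * (real (card V) - real (card I)))"
    using n by (simp add: field_simps power2_eq_square)
  then show ?thesis using n by simp
qed

section \<open>Grouping parts into two sets of balanced size\<close>

lemma card_part_le:
  assumes "finite V" "partition_on V P" "A \<in> P"
  shows "card A + card P \<le> card V + 1"
proof -
  have finP: "finite P" using finite_elements[OF assms(1,2)] .
  have fin: "finite B" if "B \<in> P" for B
    using that assms(2) by (intro finite_subset[OF _ assms(1)]) (auto simp: partition_on_def)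
  have "card P - 1 = (\<Sum>B\<in>P - {A}. 1)" using assms(3) finP by simp
  also have "\<dots> \<le> (\<Sum>B\<in>P - {A}. card B)"
  proof (rule sum_mono)
    fix B assume "B \<in> P - {A}"
    then have "B \<noteq> {}" "finite B" using assms(2) fin by (auto simp: partition_on_def)
    then show "1 \<le> card B" by (simp add: Suc_le_eq card_gt_0_iff)
  qed
  finally have "card A + (card P - 1) \<le> (\<Sum>B\<in>P. card B)"
    using sum.remove[OF finP assms(3), of card] by simp
  also have "\<dots> = card V" using product_partition[OF assms(2) fin] by simp
  finally show ?thesis by simp
qed

text \<open>With N points in c parts, each part has at most N - c + 1 points, so the greedy grouping
  has imbalance at most that. Then 4xy = N^2 - (x-y)^2 is at least N^2 - (N-c+1)^2, which is at
  least cN when 3 <= c < N. Two parts are split directly.\<close>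

lemma balanced_partition_split:
  assumes "finite V" and P: "partition_on V P"
    and c: "card P = 2 \<or> 3 \<le> card P \<and> card P < card V"
  shows "\<exists>A\<subseteq>P. card P * card V \<le> 4 * card (\<Union>A) * card (\<Union>(P - A))"
proof -
  have finP: "finite P" using finite_elements[OF assms(1) P] .
  have fin: "finite B" if "B \<in> P" for B
    using that P by (intro finite_subset[OF _ assms(1)]) (auto simp: partition_on_def)
  have card_Un: "card (\<Union>A) = sum card A" if "A \<subseteq> P" for A
  proof (rule card_Union_disjoint)
    have "disjoint P" using P by (simp add: partition_on_def)
    then show "pairwise disjnt A"
      using that unfolding pairwise_def disjnt_def disjoint_def by (meson subsetD)
  qed (use that fin in blast)
  have V: "card V = sum card P" using card_Un[of P] P by (simp add: partition_on_def)
  from c show ?thesis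
  proof
    assume c2: "card P = 2"
    then obtain A B where AB: "P = {A, B}" "A \<noteq> B" by (auto simp: card_2_iff)
    then have "A \<noteq> {}" "B \<noteq> {}" using P by (auto simp: partition_on_def)
    then have "1 \<le> card A" "1 \<le> card B" using fin AB by (auto simp: Suc_le_eq card_gt_0_iff)
    then obtain p q where pq: "card A = Suc p" "card B = Suc q" by (auto simp: Suc_le_eq gr0_conv_Suc)
    have "P - {A} = {B}" using AB by auto
    then show ?thesis using AB c2 pq V
      by (intro exI[of _ "{A}"]) (auto simp: algebra_simps)
  next
    assume c3: "3 \<le> card P \<and> card P < card V"
    define N c where "N = real (card V)" and "c = real (card P)"
    have Nc: "3 \<le> c" "c + 1 \<le> N" using c3 by (auto simp: N_def c_def)
    have "0 \<le> real (card B) \<and> real (card B) \<le> N - c + 1" if "B \<in> P" for B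
      using card_part_le[OF assms(1) P that] by (simp add: N_def c_def)
    then obtain A where A: "A \<subseteq> P"
      "\<bar>(\<Sum>B\<in>A. real (card B)) - (\<Sum>B\<in>P - A. real (card B))\<bar> \<le> N - c + 1"
      using balanced_subset[OF finP, of "N - c + 1" "\<lambda>B. real (card B)"] Nc by auto
    define x y where "x = real (card (\<Union>A))" and "y = real (card (\<Union>(P - A)))"
    have "x + y = N"
      using sum.subset_diff[OF A(1) finP, of card] card_Un[OF A(1)] card_Un[of "P - A"]
      by (simp add: x_def y_def N_def V)
    have "\<bar>x - y\<bar> \<le> N - c + 1"
      using A(2) card_Un[OF A(1)] card_Un[of "P - A"] by (simp add: x_def y_def)
    then have "\<bar>x - y\<bar>\<^sup>2 \<le> (N - c + 1)\<^sup>2" by (intro power_mono) auto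
    then have "(x - y)\<^sup>2 \<le> (N - c + 1)\<^sup>2" by simp
    moreover have "(x + y)\<^sup>2 - (x - y)\<^sup>2 = 4 * x * y" by (simp add: power2_eq_square algebra_simps)
    ultimately have "N\<^sup>2 - (N - c + 1)\<^sup>2 \<le> 4 * x * y" using \<open>x + y = N\<close> by simp
    \<comment> \<open>What is needed is (c-1)^2 <= N(c-2). Since (c+1)(c-2) = (c-1)^2 + (c-3), this
      follows from N >= c+1 and c >= 3.\<close>
    moreover have "(c + 1) * (c - 2) \<le> N * (c - 2)" using Nc by (intro mult_right_mono) auto
    ultimately have "c * N \<le> 4 * x * y" using Nc by (simp add: power2_eq_square algebra_simps)
    then have "real (card P * card V) \<le> real (4 * card (\<Union>A) * card (\<Union>(P - A)))"
      by (simp add: x_def y_def N_def c_def)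
    then show ?thesis using A(1) of_nat_le_iff by blast
  qed
qed

text \<open>In graph terms, the toughness exceeds \<open>m\<close>. The number of parts either
  permits a balanced split, or equals the number of points, in which case all parts are singletons
  and the independent set bound takes over.\<close>

lemma spectral_toughness:
  assumes G: "simple_graph V E"
    and lower: "\<And>f. a * centered_norm V f \<le> dirichlet V E f"
    and upper: "\<And>f. dirichlet V E f \<le> b * centered_norm V f"
    and ab: "m * b < (m + 1) * a" "0 < b" "0 \<le> (m :: real)"
    and S: "S \<subseteq> V" and P: "partition_on (V - S) P" "2 \<le> card P"
    and nonadj: "\<And>A B x y. A \<in> P \<Longrightarrow> B \<in> P \<Longrightarrow> A \<noteq> B \<Longrightarrow> x \<in> A \<Longrightarrow> y \<in> B \<Longrightarrow> {x, y} \<notin> E"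
  shows "m * real (card P) < real (card S)"
proof -
  have finV: "finite V" using G by (simp add: simple_graph_def)
  then have finN: "finite (V - S)" by simp
  define n N c s where "n = real (card V)" and "N = real (card (V - S))"
    and "c = real (card P)" and "s = real (card S)"
  have nNs: "n = N + s"
    using card_Diff_subset[OF finite_subset[OF S finV] S] card_mono[OF finV S]
    by (simp add: n_def N_def s_def of_nat_diff)
  have PU: "\<Union>P = V - S" using P(1) by (simp add: partition_on_def)
  obtain A where "A \<in> P" using P(2) by fastforce
  moreover from this have "card A > 0"
    using P(1) PU finN by (metis Sup_upper card_gt_0_iff finite_subset partition_on_def)
  ultimately have cN: "card P \<le> card (V - S)" using card_part_le[OF finN P(1), of A] by simp
  consider "card P = 2 \<or> 3 \<le> card P \<and> card P < card (V - S)" | "card P = card (V - S)"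
    using P(2) cN by linarith
  then show ?thesis
  proof cases
    case 1
    then obtain A where A: "A \<subseteq> P" and xy: "card P * card (V - S) \<le> 4 * card (\<Union>A) * card (\<Union>(P - A))"
      using balanced_partition_split[OF finN P(1)] by blast
    have "card P * card (V - S) > 0" using P(2) cN by simp
    then have "card (\<Union>A) > 0" "card (\<Union>(P - A)) > 0" using xy by (auto intro!: Nat.gr0I)
    then have ne: "\<Union>A \<noteq> {}" "\<Union>(P - A) \<noteq> {}" by (auto simp del: Sup_bot_conv)
    have disj: "\<Union>A \<inter> \<Union>(P - A) = {}"
      using A P(1) by (fastforce simp: partition_on_def disjoint_def)
    have "\<Union>A \<union> \<Union>(P - A) = V - S" using A PU by blast
    moreover have sub: "\<Union>A \<subseteq> V" "\<Union>(P - A) \<subseteq> V" using A PU by blast+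
    ultimately have "card (\<Union>A) + card (\<Union>(P - A)) = card (V - S)"
      using card_Un_disjoint[OF _ _ disj] finV finite_subset by metis
    then have sum: "n - real (card (\<Union>A)) - real (card (\<Union>(P - A))) = s"
      using nNs by (simp add: N_def flip: of_nat_add)
    have "{x, y} \<notin> E" if "x \<in> \<Union>A" "y \<in> \<Union>(P - A)" for x y
      using that A nonadj by blast
    from nonadjacent_sets_bound[OF finV lower upper ab sub disj ne this]
    have "4 * m * (m + 1) * real (card (\<Union>A)) * real (card (\<Union>(P - A))) < n * s"
      by (simp add: sum n_def[symmetric])
    moreover have "real (card P * card (V - S)) \<le> real (4 * card (\<Union>A) * card (\<Union>(P - A)))"
      using xy of_nat_le_iff by blast
    then have "c * N \<le> 4 * real (card (\<Union>A)) * real (card (\<Union>(P - A)))"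
      by (simp add: c_def N_def)
    then have "m * (m + 1) * (c * N) \<le> m * (m + 1) * (4 * real (card (\<Union>A)) * real (card (\<Union>(P - A))))"
      using ab(3) by (intro mult_left_mono) auto
    ultimately have less: "m * (m + 1) * (c * N) < n * s" by (simp add: algebra_simps)
    show ?thesis
    proof (rule ccontr)
      assume "\<not> ?thesis"
      then have "s \<le> m * c" by (simp add: s_def c_def)
      \<comment> \<open>The assumed bound on \<open>s\<close> is used twice: weakened to
        \<open>m * N\<close> inside \<open>n = N + s\<close>, and unchanged for the factor
        \<open>s\<close>.\<close>
      moreover have "m * c \<le> m * N" using cN ab(3) by (intro mult_left_mono) (auto simp: c_def N_def)
      ultimately have "n * s \<le> (N + m * N) * (m * c)"
        unfolding nNs by (intro mult_mono) (use ab(3) in \<open>auto simp: s_def N_def\<close>)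
      then show False using less by (simp add: algebra_simps)
    qed
  next
    case 2
    have indep: "{x, y} \<notin> E" if x: "x \<in> V - S" and y: "y \<in> V - S" for x y
    proof
      assume e: "{x, y} \<in> E"
      then have "card {x, y} = 2" using G by (auto simp: simple_graph_def)
      then have "x \<noteq> y" by auto
      obtain A B where AB: "A \<in> P" "x \<in> A" "B \<in> P" "y \<in> B" using x y PU by blast
      then have "A = B" using nonadj e by blast
      then have "card {x, y} \<le> card A"
        using AB PU finN by (intro card_mono) (auto intro: finite_subset)
      then show False using card_part_le[OF finN P(1) AB(1)] 2 \<open>x \<noteq> y\<close> by simp
    qed
    have "a * real (card V) \<le> b * (real (card V) - real (card (V - S)))"
      by (rule independent_set_bound[OF G lower upper]) (use indep P(2) 2 in auto)
    then have "a * n \<le> b * s" using nNs by (simp add: n_def[symmetric] N_def[symmetric])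
    then have "(m + 1) * (a * n) \<le> (m + 1) * (b * s)" using ab(3) by (intro mult_left_mono) auto
    moreover have "m * b * n < (m + 1) * a * n"
      using ab(1) nNs P(2) 2 by (intro mult_strict_right_mono) (auto simp: N_def s_def)
    ultimately have "b * (m * n) < b * ((m + 1) * s)" by (simp add: mult_ac)
    then have "m * n < (m + 1) * s" using ab(2) by simp
    \<comment> \<open>With \<open>n = N + s\<close>, the inequality
      \<open>m * n < (m + 1) * s\<close> reads \<open>m * N < s\<close>, and here \<open>N\<close>
      is the number of parts.\<close>
    then show ?thesis using nNs 2 by (simp add: N_def s_def algebra_simps)
  qed
qed

section \<open>Extending matchings\<close>

lemma perfect_matching_of_pairing:
  assumes M: "matching E M" and U: "\<Union>M \<subseteq> V" and f: "pairing_on (V - \<Union>M) E f"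
  shows "perfect_matching V E (M \<union> (\<lambda>x. {x, f x}) ` (V - \<Union>M))"
proof -
  let ?W = "V - \<Union>M"
  note fD = pairing_onD[OF f]
  have sub: "{x, f x} \<subseteq> ?W" if "x \<in> ?W" for x using fD(1)[OF that] that by blast
  have "disjoint (M \<union> (\<lambda>x. {x, f x}) ` ?W)"
  proof (rule disjointI)
    fix a b assume ab: "a \<in> M \<union> (\<lambda>x. {x, f x}) ` ?W" "b \<in> M \<union> (\<lambda>x. {x, f x}) ` ?W" "a \<noteq> b"
    have pairs: "{x, f x} \<inter> {y, f y} = {}" if "x \<in> ?W" "y \<in> ?W" "{x, f x} \<noteq> {y, f y}" for x y
    proof (rule ccontr)
      assume "{x, f x} \<inter> {y, f y} \<noteq> {}"
      then consider "x = y" | "x = f y" | "f x = y" | "f x = f y" by blast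
      then have "{x, f x} = {y, f y}"
        using fD(3)[OF that(1)] fD(3)[OF that(2)] by cases (metis insert_commute)+
      then show False using that(3) by simp
    qed
    have mixed: "a \<inter> {x, f x} = {}" if "a \<in> M" "x \<in> ?W" for a x
    proof -
      have "a \<subseteq> \<Union>M" using that(1) by (rule Union_upper)
      then show ?thesis using sub[OF that(2)] by blast
    qed
    have kind: "e \<in> M \<or> (\<exists>x\<in>?W. e = {x, f x})" if "e \<in> M \<union> (\<lambda>x. {x, f x}) ` ?W" for e
      using that by auto
    from kind[OF ab(1)] kind[OF ab(2)] show "a \<inter> b = {}"
    proof (elim disjE bexE)
      assume "a \<in> M" "b \<in> M"
      then show ?thesis using M ab(3) by (auto simp: matching_def disjoint_def)
    next
      fix x assume "a \<in> M" "x \<in> ?W" "b = {x, f x}"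
      then show ?thesis using mixed by simp
    next
      fix x assume "b \<in> M" "x \<in> ?W" "a = {x, f x}"
      then show ?thesis using mixed[of b x] by (simp only: Int_commute)
    next
      fix x y assume "x \<in> ?W" "a = {x, f x}" "y \<in> ?W" "b = {y, f y}"
      then show ?thesis using pairs ab(3) by simp
    qed
  qed
  moreover have "(\<lambda>x. {x, f x}) ` ?W \<subseteq> E" using fD(4) by blast
  moreover have "\<Union>(M \<union> (\<lambda>x. {x, f x}) ` ?W) = V" using sub U by blast
  ultimately show ?thesis using M by (auto simp: perfect_matching_def matching_def)
qed

lemma card_Union_matching:
  assumes "simple_graph V E" "matching E M"
  shows "card (\<Union>M) = 2 * card M"
proof -
  have M: "\<And>e. e \<in> M \<Longrightarrow> e \<subseteq> V \<and> card e = 2" "finite V" "disjoint M"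
    using assms by (auto simp: simple_graph_def matching_def)
  have "pairwise disjnt M" using M(3) by (simp add: disjoint_def pairwise_def disjnt_def)
  then have "card (\<Union>M) = sum card M"
    using M by (intro card_Union_disjoint) (auto intro: finite_subset)
  then show ?thesis using M(1) by simp
qed

text \<open>The number of odd parts has the parity of |V - S|, and thus of |S| as |V| is even; a
  strict inequality between numbers of equal parity leaves a gap of at least 2.\<close>

lemma tutte_even:
  assumes "finite V" "even (card V)" "\<nexists>f. pairing_on V E f"
  obtains S P where "S \<subseteq> V" "partition_on (V - S) P"
    "\<And>A B x y. A \<in> P \<Longrightarrow> B \<in> P \<Longrightarrow> A \<noteq> B \<Longrightarrow> x \<in> A \<Longrightarrow> y \<in> B \<Longrightarrow> {x, y} \<notin> E"
    "card S + 2 \<le> card P"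
proof -
  obtain S P where S: "S \<subseteq> V" and P: "partition_on (V - S) P"
    and nonadj: "\<forall>A\<in>P. \<forall>B\<in>P. A \<noteq> B \<longrightarrow> (\<forall>x\<in>A. \<forall>y\<in>B. {x, y} \<notin> E)"
    and odd: "card S < card {A \<in> P. odd (card A)}"
    using tutte[OF assms] by (elim exE conjE) (rule that; assumption)
  have finP: "finite P" using finite_elements[OF _ P] assms(1) by simp
  have fin: "finite A" if "A \<in> P" for A
    using that P by (intro finite_subset[OF _ assms(1)]) (auto simp: partition_on_def)
  have "card (V - S) = (\<Sum>A\<in>P. card A)" using product_partition[OF P fin] .
  then have "even (card (V - S)) \<longleftrightarrow> even (card {A \<in> P. odd (card A)})"
    using even_sum_iff[OF finP, of card] by simp
  moreover have "card (V - S) + card S = card V"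
    using card_Diff_subset[OF finite_subset[OF S assms(1)] S] card_mono[OF assms(1) S] by simp
  then have "even (card (V - S)) \<longleftrightarrow> even (card S)" using assms(2) by presburger
  ultimately have "card S + 2 \<le> card {A \<in> P. odd (card A)}" using odd by presburger
  also have "\<dots> \<le> card P" using finP by (intro card_mono) auto
  finally show thesis by (intro that[OF S P]) (use nonadj in auto)
qed

theorem theorem6:
  fixes V :: "'a set" and E :: "'a set set"
    and n m :: nat and v :: "nat \<Rightarrow> 'a" and \<mu> :: "nat \<Rightarrow> real"
  assumes "simple_graph V E"
    and "card V = n"
    and "E \<noteq> {}"
    and "even n"
    and "bij_betw v {..<n} V"
    and "\<And>i. \<mu> i = ith_eigenvalue (laplacian_mat n v E) i"
    and "m > 0"
    and "real m < real n / 2 - 1"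
    and "\<mu> 2 / \<mu> n > real m / (real m + 1)"
  shows "extendable m V E"
proof -
  note G = assms(1) and bij = assms(5) and \<mu> = assms(6)
  have finV: "finite V" using G by (simp add: simple_graph_def)
  obtain e where "e \<in> E" using assms(3) by blast
  then have "e \<subseteq> V" "card e = 2" using G by (auto simp: simple_graph_def)
  \<comment> \<open>The edge guarantees that 2 and \<open>n\<close> are indices of actual
    eigenvalues.\<close>
  then have n: "2 \<le> n" using card_mono[OF finV, of e] assms(2) by simp
  have "0 \<le> \<mu> i" if "1 \<le> i" "i \<le> n" for i
    unfolding \<mu> by (rule psd_eigenvalue_nonneg[OF laplacian_mat_carrier laplacian_mat_symmetric
        laplacian_mat_psd[OF G bij] that])
  then have "0 \<le> \<mu> 2" "0 \<le> \<mu> n" using n by auto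
  \<comment> \<open>A zero denominator would make the quotient 0 in HOL, so positivity of the
    quotient also yields that of \<open>\<mu> n\<close>.\<close>
  moreover have "0 < \<mu> 2 / \<mu> n"
    using assms(9) by (rule le_less_trans[rotated]) simp
  ultimately have pos: "0 < \<mu> 2" "0 < \<mu> n" by (auto simp: zero_less_divide_iff)
  have ratio: "real m * \<mu> n < (real m + 1) * \<mu> 2"
    using assms(9) pos by (simp add: field_simps)
  have lower: "\<mu> 2 * centered_norm V f \<le> dirichlet V E f"
    and upper: "dirichlet V E f \<le> \<mu> n * centered_norm V f" for f
    using laplacian_mat_eigenvalue_bounds[OF G bij, of f] pos n by (auto simp: \<mu>)
  \<comment> \<open>With at most \<open>m\<close> edges instead of exactly \<open>m\<close>, the
    empty matching covers the existence of a perfect matching.\<close>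
  have extend: "\<exists>P. perfect_matching V E P \<and> M \<subseteq> P" if M: "matching E M" "card M \<le> m" for M
  proof (cases "\<exists>f. pairing_on (V - \<Union>M) E f")
    case True
    moreover have "\<Union>M \<subseteq> V" using M G by (auto simp: matching_def simple_graph_def)
    ultimately show ?thesis using perfect_matching_of_pairing[OF M(1)] by blast
  next
    case False
    let ?U = "\<Union>M"
    have U: "?U \<subseteq> V" using M G by (auto simp: matching_def simple_graph_def)
    have cU: "card ?U = 2 * card M" by (rule card_Union_matching[OF G M(1)])
    have "card (V - ?U) + card ?U = card V"
      using card_Diff_subset[OF finite_subset[OF U finV] U] card_mono[OF finV U] by simp
    then have ev: "even (card (V - ?U))" using cU assms(2,4) by presburger
    have finW: "finite (V - ?U)" using finV by simp
    show ?thesis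
    proof (rule tutte_even[OF finW ev False])
      fix S P
      assume S: "S \<subseteq> V - ?U" and P: "partition_on (V - ?U - S) P"
        and nonadj: "\<And>A B x y. A \<in> P \<Longrightarrow> B \<in> P \<Longrightarrow> A \<noteq> B \<Longrightarrow> x \<in> A \<Longrightarrow> y \<in> B \<Longrightarrow> {x, y} \<notin> E"
        and card: "card S + 2 \<le> card P"
      \<comment> \<open>Here \<open>S\<close> is the Tutte set within \<open>V - ?U\<close>, of size
        k; the separating set of the overview is its union with \<open>?U\<close>.\<close>
      have "real m * real (card P) < real (card (?U \<union> S))"
      proof (rule spectral_toughness[OF G lower upper ratio pos(2)])
        show "?U \<union> S \<subseteq> V" using U S by blast
        have "V - ?U - S = V - (?U \<union> S)" by blast
        then show "partition_on (V - (?U \<union> S)) P" using P by simp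
      qed (use card nonadj in auto)
      then have "m * card P < card (?U \<union> S)" by (simp flip: of_nat_mult)
      moreover have "card (?U \<union> S) \<le> 2 * m + card S"
        using card_Un_le[of ?U S] cU M(2) by simp
      moreover have "m * (card S + 2) \<le> m * card P" using card by (rule mult_le_mono2)
      moreover have "card S \<le> m * card S" using assms(7) by simp
      ultimately have False by (simp add: algebra_simps)
      then show ?thesis ..
    qed
  qed
  show ?thesis
    unfolding extendable_def
  proof (intro conjI allI impI)
    show "\<exists>P. perfect_matching V E P"
      using extend[of "{}"] by (auto simp: matching_def)
  qed (use extend in auto)
qed

end
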